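(* Let $W=(V,B)$ be a non-degenerate formed space of Witt index $\omega\ge 2$ as described in the context, and let $1\le k\le \omega$. Let $\Gamma$ be the polar Grassmann graph of $W$ on singular $k$-subspaces. Then the following are equivalent: (i) $\Gamma$ is geodesic-transitive; (ii) $\Gamma$ is distance-regular; (iii) $k=1$ (the polar graph) or $k=\omega$ (the dual polar graph).
   Context: $V$ is a finite-dimensional vector space over $\mathbb{F}_q$ and $W=(V,B)$ is one of: a symplectic space of dimension $2\omega$ ($B$ alternating); an orthogonal space of dimension $2\omega+1$, of plus type of dimension $2\omega$, or of minus type of dimension $2\omega+2$ (non-degenerate quadratic form, $B$ its associated bilinear form); a unitary space of dimension $2\omega+1$ or $2\omega$ ($q$ a square, $B$ Hermitian). For $U\le V$, $U^\perp=\{v\in V: B(u,v)=0 \text{ for all } u\in U\}$. A subspace is singular if it is totally isotropic (totally singular for the quadratic form in the orthogonal case); the maximal singular subspaces have dimension $\omega$ (the Witt index). The polar Grassmann graph on singular $k$-subspaces has vertex set the singular $k$-subspaces of $W$; if $k=\omega$, two vertices $u,v$ are adjacent iff $\dim(u\cap v)=k-1$; if $k<\omega$, two distinct vertices $u,v$ are adjacent iff $u+v$ is a singular $(k+1)$-subspace. A geodesic of length $\ell$ is a vertex sequence $(v_0,\dots,v_\ell)$ with consecutive vertices adjacent and $d(v_0,v_\ell)=\ell$; $\Gamma$ is geodesic-transitive if $\mathrm{Aut}\,\Gamma$ is transitive on geodesics of each length. A connected graph of diameter $d$ is distance-regular if there are integers $b_i,c_i$ such that for any vertices $X,Y$ at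 distance $i$, exactly $c_i$ neighbours of $X$ are at distance $i-1$ from $Y$ and exactly $b_i$ are at distance $i+1$ from $Y$. *)

theory Defs
  imports "HOL-Analysis.Analysis"
begin

(* The underlying vector space V is F_q^n, modelled as  'a ^ 'n  with
   'a :: {field, finite}  (so 'a is F_q, q = CARD('a)) and 'n :: finite
   (so n = CARD('n)); subspaces/dimension via the library interpretation vec. *)

datatype form_kind = Symplectic | Orthogonal | Unitary

definition biadditive :: "('v::ab_group_add \<Rightarrow> 'v \<Rightarrow> 'a::field) \<Rightarrow> bool" where
  "biadditive B \<longleftrightarrow> (\<forall>x y z. B (x + y) z = B x z + B y z \<and> B z (x + y) = B z x + B z y)"

definition sesquilinear :: "('a::field \<Rightarrow> 'a) \<Rightarrow> ('a ^ 'n \<Rightarrow> 'a ^ 'n \<Rightarrow> 'a) \<Rightarrow> bool" where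
  "sesquilinear \<sigma> B \<longleftrightarrow> biadditive B \<and>
     (\<forall>c u v. B (c *s u) v = c * B u v \<and> B u (c *s v) = \<sigma> c * B u v)"

definition nondegenerate_form :: "('a::field ^ 'n \<Rightarrow> 'a ^ 'n \<Rightarrow> 'a) \<Rightarrow> bool" where
  "nondegenerate_form B \<longleftrightarrow> (\<forall>v. (\<forall>w. B v w = 0) \<longrightarrow> v = 0)"

definition symplectic_space :: "('a::field ^ 'n \<Rightarrow> 'a ^ 'n \<Rightarrow> 'a) \<Rightarrow> bool" where
  "symplectic_space B \<longleftrightarrow> sesquilinear id B \<and> (\<forall>v. B v v = 0) \<and> nondegenerate_form B"

definition orthogonal_space ::
  "('a::field ^ 'n \<Rightarrow> 'a ^ 'n \<Rightarrow> 'a) \<Rightarrow> ('a ^ 'n \<Rightarrow> 'a) \<Rightarrow> bool" where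
  "orthogonal_space B Q \<longleftrightarrow>
     (\<forall>c v. Q (c *s v) = c ^ 2 * Q v) \<and>
     (\<forall>u v. B u v = Q (u + v) - Q u - Q v) \<and>
     sesquilinear id B \<and>
     (\<forall>v. Q v = 0 \<and> (\<forall>w. B v w = 0) \<longrightarrow> v = 0)"

definition unitary_space :: "('a::{field,finite} ^ 'n \<Rightarrow> 'a ^ 'n \<Rightarrow> 'a) \<Rightarrow> bool" where
  "unitary_space B \<longleftrightarrow> (\<exists>r::nat. r * r = CARD('a) \<and>
     sesquilinear (\<lambda>x. x ^ r) B \<and> (\<forall>u v. B v u = (B u v) ^ r) \<and> nondegenerate_form B)"

definition formed_space ::
  "form_kind \<Rightarrow> ('a::{field,finite} ^ 'n \<Rightarrow> 'a ^ 'n \<Rightarrow> 'a) \<Rightarrow> ('a ^ 'n \<Rightarrow> 'a) \<Rightarrow> bool" where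
  "formed_space K B Q \<longleftrightarrow> (case K of
      Symplectic \<Rightarrow> symplectic_space B
    | Orthogonal \<Rightarrow> orthogonal_space B Q
    | Unitary \<Rightarrow> unitary_space B)"

definition singular ::
  "form_kind \<Rightarrow> ('a::field ^ 'n \<Rightarrow> 'a ^ 'n \<Rightarrow> 'a) \<Rightarrow> ('a ^ 'n \<Rightarrow> 'a) \<Rightarrow> ('a ^ 'n) set \<Rightarrow> bool" where
  "singular K B Q U \<longleftrightarrow> vec.subspace U \<and>
     (case K of Orthogonal \<Rightarrow> (\<forall>u\<in>U. Q u = 0)
              | _ \<Rightarrow> (\<forall>u\<in>U. \<forall>v\<in>U. B u v = 0))"

definition witt_index ::
  "form_kind \<Rightarrow> ('a::field ^ 'n \<Rightarrow> 'a ^ 'n \<Rightarrow> 'a) \<Rightarrow> ('a ^ 'n \<Rightarrow> 'a) \<Rightarrow> nat" where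
  "witt_index K B Q = Max {vec.dim U | U. singular K B Q U}"

definition subspace_sum :: "('a::field ^ 'n) set \<Rightarrow> ('a ^ 'n) set \<Rightarrow> ('a ^ 'n) set" where
  "subspace_sum U W = {u + w | u w. u \<in> U \<and> w \<in> W}"

definition pg_vertices ::
  "form_kind \<Rightarrow> ('a::field ^ 'n \<Rightarrow> 'a ^ 'n \<Rightarrow> 'a) \<Rightarrow> ('a ^ 'n \<Rightarrow> 'a) \<Rightarrow> nat \<Rightarrow> ('a ^ 'n) set set" where
  "pg_vertices K B Q k = {U. singular K B Q U \<and> vec.dim U = k}"

definition pg_adj ::
  "form_kind \<Rightarrow> ('a::field ^ 'n \<Rightarrow> 'a ^ 'n \<Rightarrow> 'a) \<Rightarrow> ('a ^ 'n \<Rightarrow> 'a) \<Rightarrow> nat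
     \<Rightarrow> ('a ^ 'n) set \<Rightarrow> ('a ^ 'n) set \<Rightarrow> bool" where
  "pg_adj K B Q k U W \<longleftrightarrow>
     (if k = witt_index K B Q then vec.dim (U \<inter> W) = k - 1
      else U \<noteq> W \<and> singular K B Q (subspace_sum U W) \<and> vec.dim (subspace_sum U W) = k + 1)"

definition is_walk :: "'v set \<Rightarrow> ('v \<Rightarrow> 'v \<Rightarrow> bool) \<Rightarrow> 'v list \<Rightarrow> bool" where
  "is_walk Vs E xs \<longleftrightarrow> xs \<noteq> [] \<and> set xs \<subseteq> Vs \<and>
     (\<forall>i. Suc i < length xs \<longrightarrow> E (xs ! i) (xs ! Suc i))"

definition graph_dist_is :: "'v set \<Rightarrow> ('v \<Rightarrow> 'v \<Rightarrow> bool) \<Rightarrow> 'v \<Rightarrow> 'v \<Rightarrow> nat \<Rightarrow> bool" where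
  "graph_dist_is Vs E x y n \<longleftrightarrow>
     (\<exists>xs. is_walk Vs E xs \<and> hd xs = x \<and> last xs = y \<and> length xs = Suc n) \<and>
     (\<forall>xs. is_walk Vs E xs \<and> hd xs = x \<and> last xs = y \<longrightarrow> Suc n \<le> length xs)"

definition graph_connected :: "'v set \<Rightarrow> ('v \<Rightarrow> 'v \<Rightarrow> bool) \<Rightarrow> bool" where
  "graph_connected Vs E \<longleftrightarrow> Vs \<noteq> {} \<and>
     (\<forall>x\<in>Vs. \<forall>y\<in>Vs. \<exists>xs. is_walk Vs E xs \<and> hd xs = x \<and> last xs = y)"

definition is_geodesic :: "'v set \<Rightarrow> ('v \<Rightarrow> 'v \<Rightarrow> bool) \<Rightarrow> 'v list \<Rightarrow> bool" where
  "is_geodesic Vs E xs \<longleftrightarrow> is_walk Vs E xs \<and>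
     graph_dist_is Vs E (hd xs) (last xs) (length xs - 1)"

definition graph_aut :: "'v set \<Rightarrow> ('v \<Rightarrow> 'v \<Rightarrow> bool) \<Rightarrow> ('v \<Rightarrow> 'v) \<Rightarrow> bool" where
  "graph_aut Vs E f \<longleftrightarrow> bij_betw f Vs Vs \<and>
     (\<forall>x\<in>Vs. \<forall>y\<in>Vs. E x y \<longleftrightarrow> E (f x) (f y))"

definition geodesic_transitive :: "'v set \<Rightarrow> ('v \<Rightarrow> 'v \<Rightarrow> bool) \<Rightarrow> bool" where
  "geodesic_transitive Vs E \<longleftrightarrow>
     (\<forall>xs ys. is_geodesic Vs E xs \<and> is_geodesic Vs E ys \<and> length xs = length ys \<longrightarrow>
        (\<exists>f. graph_aut Vs E f \<and> map f xs = ys))"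

definition distance_regular :: "'v set \<Rightarrow> ('v \<Rightarrow> 'v \<Rightarrow> bool) \<Rightarrow> bool" where
  "distance_regular Vs E \<longleftrightarrow> graph_connected Vs E \<and>
     (\<exists>b c :: nat \<Rightarrow> nat. \<forall>i x y. x \<in> Vs \<and> y \<in> Vs \<and> graph_dist_is Vs E x y i \<longrightarrow>
        (1 \<le> i \<longrightarrow> card {z\<in>Vs. E x z \<and> graph_dist_is Vs E z y (i - 1)} = c i) \<and>
        card {z\<in>Vs. E x z \<and> graph_dist_is Vs E z y (i + 1)} = b i)"

end

theory Submission
  imports Defs "HOL-Computational_Algebra.Polynomial"
begin

text \<open>A version of Witt's theorem for hyperbolic frames makes the isometry group transitive on frames
  \<open>(e\<^sub>i, f\<^sub>i)\<close> of a given length. For \<open>k = 1\<close> and \<open>k = \<omega>\<close> every geodesic is read off from a frame by a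
  recipe that depends only on its length, which gives geodesic-transitivity, and distance-regularity
  follows by transporting spheres along automorphisms. For \<open>1 < k < \<omega>\<close> the number of common
  neighbours of two vertices at distance 2 is not constant, while both conditions force it to be.\<close>

section \<open>Geodesic-transitive and distance-regular graphs\<close>

text \<open>Witt's theorem in full extends isometries between arbitrary subspaces. Restricting it to
  hyperbolic frames avoids comparing anisotropic complements: one hyperbolic pair is moved to
  another by isometries of the whole space that fix the vectors already in place. The price is that
  each geodesic has to be completed to a frame, by a Gram-Schmidt process that keeps the partners
  dictated by the geodesic. Orthogonal spaces in characteristic 2 shape the statements: there
  \<open>B\<close> may have a radical and does not determine \<open>Q\<close>. Hence isometries
  preserve \<open>q\<close> separately, nondegeneracy speaks of vectors with \<open>q v = 0\<close>,
  and duality compares functionals rather than vectors. Geodesic-transitivity as defined does not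
  include connectedness, so distance-regularity also requires a proof that the graph is connected.
  This is done for the two extreme values of \<open>k\<close>; in between, the count at distance 2
  refutes each condition directly.\<close>

lemma graph_aut_inverse:
  assumes "graph_aut V E f"
  shows "graph_aut V E (inv_into V f)"
proof -
  have bij: "bij_betw f V V" and E: "\<And>x y. x \<in> V \<Longrightarrow> y \<in> V \<Longrightarrow> E x y \<longleftrightarrow> E (f x) (f y)"
    using assms unfolding graph_aut_def by auto
  have "inv_into V f x \<in> V" "f (inv_into V f x) = x" if "x \<in> V" for x
    using bij that by (auto simp: bij_betw_def f_inv_into_f inv_into_into)
  then show ?thesis
    unfolding graph_aut_def using bij_betw_inv_into[OF bij] E by metis
qed

lemma is_walk_map:
  assumes "graph_aut V E f" "is_walk V E xs"
  shows "is_walk V E (map f xs)"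
proof -
  have "f ` V = V"
    using assms(1) unfolding graph_aut_def bij_betw_def by blast
  moreover have "E (f (xs ! i)) (f (xs ! Suc i))" if "Suc i < length xs" for i
    using assms that unfolding graph_aut_def is_walk_def
    by (metis Suc_lessD nth_mem subset_iff)
  ultimately show ?thesis
    using assms(2) unfolding is_walk_def by auto
qed

lemma is_walk_ends: "is_walk V E xs \<Longrightarrow> hd xs \<in> V \<and> last xs \<in> V"
  unfolding is_walk_def by auto

lemma graph_dist_is_ends: "graph_dist_is V E x y n \<Longrightarrow> x \<in> V \<and> y \<in> V"
  unfolding graph_dist_is_def using is_walk_ends by metis

lemma graph_dist_is_unique: "graph_dist_is V E x y m \<Longrightarrow> graph_dist_is V E x y n \<Longrightarrow> m = n"
  unfolding graph_dist_is_def by (metis Suc_le_mono le_antisym)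

lemma graph_dist_is_aut:
  assumes f: "graph_aut V E f" and d: "graph_dist_is V E x y n"
  shows "graph_dist_is V E (f x) (f y) n"
  unfolding graph_dist_is_def
proof (intro conjI allI impI)
  obtain xs where "is_walk V E xs" "hd xs = x" "last xs = y" "length xs = Suc n"
    using d unfolding graph_dist_is_def by blast
  then show "\<exists>xs. is_walk V E xs \<and> hd xs = f x \<and> last xs = f y \<and> length xs = Suc n"
    using is_walk_map[OF f, of xs]
    by (intro exI[of _ "map f xs"]) (auto simp: is_walk_def hd_map last_map)
next
  fix xs assume xs: "is_walk V E xs \<and> hd xs = f x \<and> last xs = f y"
  have "inv_into V f (f x) = x" "inv_into V f (f y) = y"
    using f graph_dist_is_ends[OF d] unfolding graph_aut_def bij_betw_def by auto
  then have "is_walk V E (map (inv_into V f) xs) \<and>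
      hd (map (inv_into V f) xs) = x \<and> last (map (inv_into V f) xs) = y"
    using xs is_walk_map[OF graph_aut_inverse[OF f], of xs]
    by (auto simp: is_walk_def hd_map last_map)
  then have "Suc n \<le> length (map (inv_into V f) xs)"
    using d unfolding graph_dist_is_def by blast
  then show "Suc n \<le> length xs" by simp
qed

lemma graph_dist_is_aut_iff:
  assumes f: "graph_aut V E f" and "x \<in> V" "y \<in> V"
  shows "graph_dist_is V E (f x) (f y) n \<longleftrightarrow> graph_dist_is V E x y n"
proof
  have "inv_into V f (f x) = x" "inv_into V f (f y) = y"
    using assms unfolding graph_aut_def bij_betw_def by auto
  then show "graph_dist_is V E (f x) (f y) n \<Longrightarrow> graph_dist_is V E x y n"
    using graph_dist_is_aut[OF graph_aut_inverse[OF f], of "f x" "f y" n] by simp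
qed (rule graph_dist_is_aut[OF f])

text \<open>Both pairs are ends of geodesics of length \<open>i\<close>, and an automorphism
  carrying one geodesic to the other carries the counted sets along. As \<open>j\<close> is free,
  this gives the constants \<open>b\<close> and \<open>c\<close> together.\<close>

lemma geodesic_transitive_sphere_card:
  assumes "geodesic_transitive V E"
    and "graph_dist_is V E x y i" "graph_dist_is V E x' y' i"
  shows "card {z\<in>V. E x z \<and> graph_dist_is V E z y j} = card {z\<in>V. E x' z \<and> graph_dist_is V E z y' j}"
proof -
  have geodesic: "\<exists>xs. is_geodesic V E xs \<and> hd xs = x \<and> last xs = y \<and> length xs = Suc i"
    if "graph_dist_is V E x y i" for x y
    using that unfolding is_geodesic_def graph_dist_is_def
    by (metis diff_Suc_1)
  obtain xs ys where xs: "is_geodesic V E xs" "hd xs = x" "last xs = y" "length xs = Suc i"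
    and ys: "is_geodesic V E ys" "hd ys = x'" "last ys = y'" "length ys = Suc i"
    using geodesic[OF assms(2)] geodesic[OF assms(3)] by blast
  obtain f where f: "graph_aut V E f" "map f xs = ys"
    using assms(1) xs ys unfolding geodesic_transitive_def by metis
  have "xs \<noteq> []" using xs by auto
  then have fxy: "f x = x'" "f y = y'"
    using f(2) xs ys by (auto simp: hd_map last_map)
  have bij: "bij_betw f V V" and E: "\<And>x y. x \<in> V \<Longrightarrow> y \<in> V \<Longrightarrow> E (f x) (f y) \<longleftrightarrow> E x y"
    using f(1) unfolding graph_aut_def by auto
  have xy: "x \<in> V" "y \<in> V"
    using graph_dist_is_ends[OF assms(2)] by auto
  have "bij_betw f {z\<in>V. E x z \<and> graph_dist_is V E z y j} {z\<in>V. E x' z \<and> graph_dist_is V E z y' j}"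
    unfolding bij_betw_def
  proof
    show "inj_on f {z\<in>V. E x z \<and> graph_dist_is V E z y j}"
      using bij by (auto simp: bij_betw_def inj_on_def)
    have "f z \<in> V" if "z \<in> V" for z
      using bij that by (auto simp: bij_betw_def)
    moreover have "\<exists>z\<in>V. z' = f z" if "z' \<in> V" for z'
      using bij that by (auto simp: bij_betw_def)
    ultimately show "f ` {z\<in>V. E x z \<and> graph_dist_is V E z y j} = {z\<in>V. E x' z \<and> graph_dist_is V E z y' j}"
      using E[OF xy(1)] graph_dist_is_aut_iff[OF f(1) _ xy(2)] unfolding fxy[symmetric]
      by (intro set_eqI) (smt (verit) image_iff mem_Collect_eq)
  qed
  then show ?thesis
    by (rule bij_betw_same_card)
qed

lemma geodesic_transitive_imp_distance_regular:
  assumes "geodesic_transitive V E" "graph_connected V E"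
  shows "distance_regular V E"
proof -
  \<comment> \<open>A representative pair at distance \<open>i\<close>. If there is none, the choice
    is arbitrary and the condition for this \<open>i\<close> is vacuous.\<close>
  define p where "p i = (SOME p. graph_dist_is V E (fst p) (snd p) i)" for i
  define F where "F i j = card {z\<in>V. E (fst (p i)) z \<and> graph_dist_is V E z (snd (p i)) j}" for i j
  have "card {z\<in>V. E x z \<and> graph_dist_is V E z y j} = F i j" if "graph_dist_is V E x y i" for x y i j
  proof -
    have "graph_dist_is V E (fst (p i)) (snd (p i)) i"
      unfolding p_def by (rule someI[of _ "(x, y)"]) (simp add: that)
    then show ?thesis
      unfolding F_def using geodesic_transitive_sphere_card[OF assms(1) that] by blast
  qed
  then show ?thesis
    unfolding distance_regular_def
    by (intro conjI assms(2) exI[of _ "\<lambda>i. F i (i + 1)"] exI[of _ "\<lambda>i. F i (i - 1)"]) auto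
qed

section \<open>Distances at most 2 and common neighbours\<close>

lemma is_walk_singleton: "is_walk V E [x] \<longleftrightarrow> x \<in> V"
  unfolding is_walk_def by auto

lemma is_walk_Cons: "is_walk V E (x # y # xs) \<longleftrightarrow> x \<in> V \<and> E x y \<and> is_walk V E (y # xs)"
  unfolding is_walk_def by (auto simp: nth_Cons split: nat.splits)

lemma graph_dist_is_0: "x \<in> V \<Longrightarrow> graph_dist_is V E x x 0"
  unfolding graph_dist_is_def using is_walk_singleton[of V E x]
  by (auto intro!: exI[of _ "[x]"] simp: is_walk_def Suc_le_eq)

lemma walk_cases:
  assumes "is_walk V E xs"
  shows "(\<exists>x. xs = [x]) \<or> (\<exists>x y. xs = [x, y] \<and> E x y) \<or> (\<exists>x y z zs. xs = x # y # z # zs)"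
  using assms by (cases xs; cases "tl xs"; cases "tl (tl xs)") (auto simp: is_walk_def)

text \<open>\<open>E\<close> is not assumed irreflexive, so \<open>x \<noteq> y\<close> is demanded
  separately.\<close>

lemma graph_dist_is_1:
  assumes "x \<in> V" "y \<in> V"
  shows "graph_dist_is V E x y 1 \<longleftrightarrow> x \<noteq> y \<and> E x y"
proof
  assume d: "graph_dist_is V E x y 1"
  then have "x \<noteq> y"
    using graph_dist_is_0[OF assms(1)] graph_dist_is_unique by fastforce
  moreover obtain xs where "is_walk V E xs" "hd xs = x" "last xs = y" "length xs = Suc 1"
    using d unfolding graph_dist_is_def by blast
  ultimately show "x \<noteq> y \<and> E x y"
    by (cases xs; cases "tl xs") (auto simp: is_walk_Cons)
next
  assume xy: "x \<noteq> y \<and> E x y"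
  have "Suc 1 \<le> length xs" if "is_walk V E xs \<and> hd xs = x \<and> last xs = y" for xs
    using that xy walk_cases[of V E xs] by auto
  then show "graph_dist_is V E x y 1"
    unfolding graph_dist_is_def using xy assms
    by (auto intro!: exI[of _ "[x, y]"] simp: is_walk_Cons is_walk_singleton)
qed

lemma graph_dist_is_2:
  assumes "x \<in> V" "y \<in> V" "z \<in> V" "x \<noteq> y" "\<not> E x y" "E x z" "E z y"
  shows "graph_dist_is V E x y 2"
proof -
  have "Suc 2 \<le> length xs" if "is_walk V E xs \<and> hd xs = x \<and> last xs = y" for xs
    using that assms walk_cases[of V E xs] by auto
  then show ?thesis
    unfolding graph_dist_is_def using assms
    by (auto intro!: exI[of _ "[x, z, y]"] simp: is_walk_Cons is_walk_singleton)
qed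

text \<open>The invariant that excludes the intermediate values of \<open>k\<close>. Both conditions
  imply it, so a single count refutes either of them.\<close>

lemma common_neighbours_card:
  assumes "geodesic_transitive V E \<or> distance_regular V E"
    and xy: "graph_dist_is V E x y 2" and xy': "graph_dist_is V E x' y' 2"
  shows "card {z\<in>V. E x z \<and> z \<noteq> y \<and> E z y} = card {z\<in>V. E x' z \<and> z \<noteq> y' \<and> E z y'}"
proof -
  have "card {z\<in>V. E x z \<and> graph_dist_is V E z y 1} = card {z\<in>V. E x' z \<and> graph_dist_is V E z y' 1}"
    using assms(1)
  proof
    assume "geodesic_transitive V E"
    then show ?thesis
      by (rule geodesic_transitive_sphere_card[OF _ xy xy'])
  next
    assume "distance_regular V E"
    then obtain c where c: "\<And>i x y. x \<in> V \<Longrightarrow> y \<in> V \<Longrightarrow> graph_dist_is V E x y i \<Longrightarrow> 1 \<le> i \<Longrightarrow>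
        card {z\<in>V. E x z \<and> graph_dist_is V E z y (i - 1)} = c i"
      unfolding distance_regular_def by blast
    have "card {z\<in>V. E x z \<and> graph_dist_is V E z y (2 - 1)} = c 2" if "graph_dist_is V E x y 2" for x y
      using c[of x y 2] graph_dist_is_ends[OF that] that by simp
    from this[OF xy] this[OF xy'] show ?thesis by simp
  qed
  moreover have "{z\<in>V. E x z \<and> graph_dist_is V E z y 1} = {z\<in>V. E x z \<and> z \<noteq> y \<and> E z y}"
    if "graph_dist_is V E x y 2" for x y
    using graph_dist_is_1[of _ V y E] graph_dist_is_ends[OF that] by blast
  ultimately show ?thesis
    using xy xy' by simp
qed

section \<open>Linear algebra\<close>

abbreviation linear_map :: "('a::field ^ 'n \<Rightarrow> 'a ^ 'm) \<Rightarrow> bool" where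
  "linear_map \<equiv> Vector_Spaces.linear (*s) (*s)"

lemma linear_mapI:
  assumes "\<And>u v. g (u + v) = g u + g v" "\<And>c v. g (c *s v) = c *s g v"
  shows "linear_map g"
  using assms by (simp add: Vector_Spaces.linear_iff vec.vector_space_axioms)

text \<open>The basis grows from the smallest space upwards: a basis of \<open>A l\<close> receives
  the indices from \<open>l\<close> on, then each \<open>A j\<close> contributes a vector outside
  \<open>A (Suc j)\<close> at index \<open>j\<close>. The vectors chosen before span a subspace of
  \<open>A (Suc j)\<close>, so independence persists.\<close>

lemma decreasing_chain_basis:
  fixes A :: "nat \<Rightarrow> ('a::field ^ 'n) set"
  assumes sub: "\<And>j. j \<le> l \<Longrightarrow> vec.subspace (A j)"
    and dim: "\<And>j. j \<le> l \<Longrightarrow> vec.dim (A j) = m - j"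
    and dec: "\<And>j. j < l \<Longrightarrow> A (Suc j) \<subseteq> A j" and lm: "l \<le> m"
  shows "\<exists>e. inj_on e {..<m} \<and> vec.independent (e ` {..<m}) \<and> (\<forall>t\<le>l. e ` {t..<m} \<subseteq> A t)"
proof -
  have "0 \<le> l" by simp
  then have "\<exists>e. inj_on e {0..<m} \<and> vec.independent (e ` {0..<m}) \<and> (\<forall>t\<in>{0..l}. e ` {t..<m} \<subseteq> A t)"
  proof (induction rule: inc_induct)
    case base
    obtain b where b: "b \<subseteq> A l" "vec.independent b" "A l \<subseteq> vec.span b" "card b = vec.dim (A l)"
      by (rule vec.basis_exists)
    then have "finite b"
      using vec.finiteI_independent by blast
    then obtain e where "bij_betw e {l..<m} b"
      using b(4) dim[OF order_refl] finite_same_card_bij[of "{l..<m}" b] by auto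
    then show ?case
      using b by (intro exI[of _ e]) (auto simp: bij_betw_def)
  next
    case (step j)
    then obtain e where e: "inj_on e {Suc j..<m}" "vec.independent (e ` {Suc j..<m})"
      "\<And>t. t \<in> {Suc j..l} \<Longrightarrow> e ` {t..<m} \<subseteq> A t"
      by blast
    have jl: "j < l" "j < m"
      using step lm by auto
    have "A (Suc j) \<noteq> A j"
      using dim[of j] dim[of "Suc j"] jl by auto
    then obtain x where x: "x \<in> A j" "x \<notin> A (Suc j)"
      using dec[OF jl(1)] by blast
    define e' where "e' = e(j := x)"
    have upd: "e' ` {t..<m} = e ` {t..<m}" if "j < t" for t
      using that by (auto simp: e'_def)
    have ins: "{j..<m} = insert j {Suc j..<m}"
      using jl by auto
    have img: "e' ` {j..<m} = insert x (e ` {Suc j..<m})"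
      unfolding ins image_insert using upd[of "Suc j"] by (simp, simp add: e'_def)
    have "vec.span (e ` {Suc j..<m}) \<subseteq> A (Suc j)"
      using e(3)[of "Suc j"] jl sub[of "Suc j"] by (intro vec.span_minimal) auto
    then have x': "x \<notin> vec.span (e ` {Suc j..<m})"
      using x(2) by blast
    then have "vec.independent (e' ` {j..<m})"
      unfolding img using e(2) by (rule vec.independent_insertI)
    moreover have "inj_on e' {j..<m}"
      unfolding ins using e(1) vec.span_base[of x "e ` {Suc j..<m}"] x'
      by (auto simp: inj_on_def e'_def)
    moreover have "e' ` {t..<m} \<subseteq> A t" if "t \<in> {j..l}" for t
    proof (cases "t = j")
      case True
      then show ?thesis
        using img x(1) e(3)[of "Suc j"] jl dec[OF jl(1)] by auto
    next
      case False
      then show ?thesis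
        using that upd[of t] e(3)[of t] by auto
    qed
    ultimately show ?case by blast
  qed
  then show ?thesis
    by (simp only: atLeast0LessThan atLeast0AtMost Ball_def atMost_iff)
qed

section \<open>Polar spaces and their isometries\<close>

text \<open>Symplectic, orthogonal and unitary spaces at once: \<open>q\<close> is the quadratic form in the orthogonal
  case and \<open>v \<mapsto> B v v\<close> otherwise, \<open>\<sigma>\<close> is the field automorphism of the sesquilinear form, \<open>\<epsilon>\<close> its
  sign, and \<open>\<tau>\<close> is the trace map that occurs in the polarization of \<open>q\<close>.\<close>

locale polar_space =
  fixes K :: form_kind
    and B :: "'a::field ^ 'n \<Rightarrow> 'a ^ 'n \<Rightarrow> 'a"
    and Q :: "'a ^ 'n \<Rightarrow> 'a"
    and q :: "'a ^ 'n \<Rightarrow> 'a"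
    and \<sigma> :: "'a \<Rightarrow> 'a" and \<epsilon> :: 'a and \<tau> :: "'a \<Rightarrow> 'a"
  assumes add_left: "B (u + v) w = B u w + B v w"
    and add_right: "B w (u + v) = B w u + B w v"
    and scale_left: "B (c *s u) v = c * B u v"
    and scale_right: "B u (c *s v) = \<sigma> c * B u v"
    and \<sigma>_mult: "\<sigma> (a * b) = \<sigma> a * \<sigma> b"
    and \<sigma>_\<sigma>: "\<sigma> (\<sigma> a) = a"
    and \<epsilon>_\<epsilon>: "\<epsilon> * \<epsilon> = 1"
    and \<sigma>_\<epsilon>: "\<sigma> \<epsilon> = \<epsilon>"
    and swap: "B v u = \<epsilon> * \<sigma> (B u v)"
    and q_scale: "q v = 0 \<Longrightarrow> q (c *s v) = 0"
    and q_add: "q (u + v) = q u + q v + \<tau> (B u v)"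
    and \<tau>_0: "\<tau> 0 = 0"
    and \<tau>_onto: "\<exists>a. q v + \<tau> a = 0"
    and q_isotropic: "q v = 0 \<Longrightarrow> B v v = 0"
    and nondeg: "q v = 0 \<Longrightarrow> (\<And>w. B v w = 0) \<Longrightarrow> v = 0"
    and singular_iff: "singular K B Q U \<longleftrightarrow>
      vec.subspace U \<and> (\<forall>u\<in>U. q u = 0) \<and> (\<forall>u\<in>U. \<forall>v\<in>U. B u v = 0)"
begin

lemma zero_left [simp]: "B 0 v = 0"
  using add_left[of 0 0 v] by (simp only: add_0_left add_cancel_right_right)

lemma zero_right [simp]: "B v 0 = 0"
  using add_right[of v 0 0] by (simp only: add_0_left add_cancel_right_right)

lemma \<sigma>_0 [simp]: "\<sigma> 0 = 0"
  using \<sigma>_mult[of 0 "\<sigma> 0"] by (simp add: \<sigma>_\<sigma>)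

lemma \<sigma>_1 [simp]: "\<sigma> 1 = 1"
  using \<sigma>_mult[of "\<sigma> 1" 1] by (simp add: \<sigma>_\<sigma>)

lemma \<epsilon>_nonzero [simp]: "\<epsilon> \<noteq> 0"
  using \<epsilon>_\<epsilon> by auto

lemma \<sigma>_eq_0 [simp]: "\<sigma> a = 0 \<longleftrightarrow> a = 0"
  using \<sigma>_\<sigma>[of a] by auto

lemma orth_sym: "B u v = 0 \<longleftrightarrow> B v u = 0"
  by (subst swap) simp

lemma minus_left: "B (- u) v = - B u v"
  using add_left[of "- u" u v] by (simp add: eq_neg_iff_add_eq_0)

lemma minus_right: "B v (- u) = - B v u"
  using add_right[of v "- u" u] by (simp add: eq_neg_iff_add_eq_0)

lemma diff_left: "B (u - v) w = B u w - B v w"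
  using add_left[of u "- v" w] by (simp add: minus_left)

lemma diff_right: "B w (u - v) = B w u - B w v"
  using add_right[of w u "- v"] by (simp add: minus_right)

lemma sum_left: "B (\<Sum>i\<in>I. f i) v = (\<Sum>i\<in>I. B (f i) v)"
  by (induction I rule: infinite_finite_induct) (simp_all add: add_left)

lemmas form_simps = add_left add_right diff_left diff_right scale_left scale_right
  minus_left minus_right

lemma q_0 [simp]: "q 0 = 0"
  using q_add[of 0 0] by (simp only: \<tau>_0 zero_left add_0_left add_0_right add_cancel_right_right)

section \<open>Isometries and hyperbolic pairs\<close>

definition isometry :: "('a ^ 'n \<Rightarrow> 'a ^ 'n) \<Rightarrow> bool" where
  "isometry g \<longleftrightarrow> linear_map g \<and> (\<forall>u v. B (g u) (g v) = B u v) \<and> (\<forall>v. q (g v) = q v)"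

lemma isometry_compose: "isometry g \<Longrightarrow> isometry h \<Longrightarrow> isometry (h \<circ> g)"
  unfolding isometry_def by (auto intro: Vector_Spaces.linear_compose)

lemma isometry_id: "isometry id"
  unfolding isometry_def by (simp add: vec.linear_id)

text \<open>A vector of the kernel has \<open>q v = 0\<close> and is orthogonal to everything, so it
  vanishes; finite dimension does the rest.\<close>

lemma isometry_bij:
  assumes "isometry g"
  shows "bij g"
proof -
  have lin: "linear_map g" and Bg: "B (g u) (g v) = B u v" and qg: "q (g v) = q v" for u v
    using assms unfolding isometry_def by auto
  have "v = 0" if "g v = 0" for v
    by (metis Bg nondeg q_0 qg that zero_left)
  then have "inj g"
    using lin by (simp add: vec.linear_inj_iff_eq_0)
  then show ?thesis
    using vec.linear_inj_imp_surj[OF lin] by (simp add: bij_def)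
qed

definition hyp_pair :: "'a ^ 'n \<Rightarrow> 'a ^ 'n \<Rightarrow> bool" where
  "hyp_pair e f \<longleftrightarrow> q e = 0 \<and> q f = 0 \<and> B e f = 1"

lemma hyp_pair_simps:
  assumes "hyp_pair e f"
  shows "q e = 0" "q f = 0" "B e f = 1" "B f e = \<epsilon>" "B e e = 0" "B f f = 0"
  using assms swap[of f e] unfolding hyp_pair_def by (auto intro: q_isotropic)

text \<open>The space is the direct sum of the plane spanned by \<open>e\<close> and
  \<open>f\<close> and its orthogonal complement. The isometry is glued from
  \<open>e \<mapsto> e'\<close>, \<open>f \<mapsto> f'\<close> and \<open>\<psi>\<close> on the
  complement; all elementary isometries below arise from explicit choices of
  \<open>\<psi>\<close>.\<close>

lemma isometry_from_hyp_pair: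
  assumes ef: "hyp_pair e f" and ef': "hyp_pair e' f'" and lin: "linear_map \<psi>"
    and orth: "\<And>u. B u e = 0 \<Longrightarrow> B u f = 0 \<Longrightarrow> B (\<psi> u) e' = 0 \<and> B (\<psi> u) f' = 0"
    and B\<psi>: "\<And>u v. B u e = 0 \<Longrightarrow> B u f = 0 \<Longrightarrow> B v e = 0 \<Longrightarrow> B v f = 0 \<Longrightarrow> B (\<psi> u) (\<psi> v) = B u v"
    and q\<psi>: "\<And>u. B u e = 0 \<Longrightarrow> B u f = 0 \<Longrightarrow> q (\<psi> u) = q u"
  shows "\<exists>g. isometry g \<and> g e = e' \<and> g f = f' \<and> (\<forall>u. B u e = 0 \<longrightarrow> B u f = 0 \<longrightarrow> g u = \<psi> u)"
proof -
  note E = hyp_pair_simps[OF ef] and E' = hyp_pair_simps[OF ef']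
  \<comment> \<open>\<open>p\<close> projects onto the complement. As \<open>B e f = 1\<close> and
    \<open>B f e = \<epsilon>\<close> with \<open>\<epsilon> * \<epsilon> = 1\<close>, the
    coefficient of \<open>e\<close> in \<open>v\<close> is \<open>B v f\<close> and that of
    \<open>f\<close> is \<open>\<epsilon> * B v e\<close>.\<close>
  define p where "p v = v - B v f *s e - (\<epsilon> * B v e) *s f" for v
  define g where "g v = B v f *s e' + (\<epsilon> * B v e) *s f' + \<psi> (p v)" for v
  note \<psi>_simps = vec.linear_add[OF lin] vec.linear_scale[OF lin] vec.linear_0[OF lin]
  have p_add: "p (u + v) = p u + p v" and p_scale: "p (c *s v) = c *s p v" for u v c
    unfolding p_def by (simp_all add: form_simps vec.scale_left_distrib vec.scale_right_diff_distrib
        vec.scale_scale algebra_simps)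
  have p_orth: "B (p v) e = 0" "B (p v) f = 0" for v
    unfolding p_def by (simp_all add: form_simps E \<epsilon>_\<epsilon> mult.commute)
  have decomp: "v = B v f *s e + (\<epsilon> * B v e) *s f + p v" for v
    unfolding p_def by simp
  have form_decomp: "B (a *s e + b *s f + u) (c *s e + d *s f + v) = a * \<sigma> d + b * \<sigma> c * \<epsilon> + B u v"
    if "hyp_pair e f" "B u e = 0" "B u f = 0" "B v e = 0" "B v f = 0" for a b c d e f u v
    using that(2-) that(4,5)[unfolded orth_sym[of v]]
    by (simp add: form_simps hyp_pair_simps[OF that(1)] algebra_simps)
  have q_decomp: "q (a *s e + b *s f + u) = \<tau> (a * \<sigma> b) + q u"
    if "hyp_pair e f" "B u e = 0" "B u f = 0" for a b e f u
    using that(2-)[unfolded orth_sym[of u]]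
    by (simp add: q_add form_simps hyp_pair_simps[OF that(1)] q_scale mult.commute \<tau>_0)
  have "linear_map g"
    by (rule linear_mapI) (simp_all add: g_def p_add p_scale \<psi>_simps form_simps
      vec.scale_left_distrib vec.scale_right_distrib vec.scale_scale algebra_simps)
  moreover have "B (g u) (g v) = B u v" for u v
  proof -
    have "B (g u) (g v) = B u f * \<sigma> (\<epsilon> * B v e) + (\<epsilon> * B u e) * \<sigma> (B v f) * \<epsilon> + B (\<psi> (p u)) (\<psi> (p v))"
      unfolding g_def using orth[OF p_orth] by (intro form_decomp[OF ef']) auto
    also have "B (\<psi> (p u)) (\<psi> (p v)) = B (p u) (p v)"
      by (rule B\<psi>[OF p_orth p_orth])
    also have "B u f * \<sigma> (\<epsilon> * B v e) + (\<epsilon> * B u e) * \<sigma> (B v f) * \<epsilon> + B (p u) (p v) =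
        B (B u f *s e + (\<epsilon> * B u e) *s f + p u) (B v f *s e + (\<epsilon> * B v e) *s f + p v)"
      by (rule form_decomp[OF ef p_orth p_orth, symmetric])
    finally show ?thesis
      by (simp flip: decomp)
  qed
  moreover have "q (g v) = q v" for v
  proof -
    have "q (g v) = \<tau> (B v f * \<sigma> (\<epsilon> * B v e)) + q (\<psi> (p v))"
      unfolding g_def using orth[OF p_orth] by (intro q_decomp[OF ef']) auto
    also have "q (\<psi> (p v)) = q (p v)"
      by (rule q\<psi>[OF p_orth])
    also have "\<tau> (B v f * \<sigma> (\<epsilon> * B v e)) + q (p v) = q (B v f *s e + (\<epsilon> * B v e) *s f + p v)"
      by (rule q_decomp[OF ef p_orth, symmetric])
    finally show ?thesis
      by (simp flip: decomp)
  qed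
  moreover have "g e = e'" "g f = f'"
    unfolding g_def p_def by (simp_all add: E \<psi>_simps \<epsilon>_\<epsilon>)
  moreover have "g u = \<psi> u" if "B u e = 0" "B u f = 0" for u
    using that unfolding g_def p_def by simp
  ultimately show ?thesis
    unfolding isometry_def by blast
qed

text \<open>\<open>P\<close> holds the vectors that already have their final position, so that
  frames can be aligned pair by pair.\<close>

definition hyp_equiv :: "('a ^ 'n) set \<Rightarrow> 'a ^ 'n \<Rightarrow> 'a ^ 'n \<Rightarrow> 'a ^ 'n \<Rightarrow> 'a ^ 'n \<Rightarrow> bool" where
  "hyp_equiv P e f e' f' \<longleftrightarrow> (\<exists>g. isometry g \<and> g e = e' \<and> g f = f' \<and> (\<forall>u\<in>P. g u = u))"

lemma hyp_equiv_trans: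
  "hyp_equiv P e f e' f' \<Longrightarrow> hyp_equiv P e' f' e'' f'' \<Longrightarrow> hyp_equiv P e f e'' f''"
  unfolding hyp_equiv_def by (metis comp_apply isometry_compose)

definition orth_to :: "('a ^ 'n) set \<Rightarrow> 'a ^ 'n \<Rightarrow> bool" where
  "orth_to P v \<longleftrightarrow> (\<forall>u\<in>P. B u v = 0)"

lemma orth_to_simps:
  "orth_to P u \<Longrightarrow> orth_to P v \<Longrightarrow> orth_to P (u + v)"
  "orth_to P u \<Longrightarrow> orth_to P (c *s u)"
  unfolding orth_to_def by (simp_all add: form_simps)

text \<open>The map fixes \<open>e\<close>, sends \<open>f\<close> to \<open>f'\<close> and \<open>u \<in> {e, f}\<^sup>\<bottom>\<close> to \<open>u - B u f' e\<close>, an element of \<open>{e, f'}\<^sup>\<bottom>\<close>.\<close>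

lemma hyp_equiv_same_left:
  assumes ef: "hyp_pair e f" and ef': "hyp_pair e f'"
    and P: "orth_to P e" "orth_to P f" "orth_to P f'"
  shows "hyp_equiv P e f e f'"
proof -
  note E = hyp_pair_simps[OF ef] and E' = hyp_pair_simps[OF ef']
  define \<psi> where "\<psi> u = u - B u f' *s e" for u
  have "\<exists>g. isometry g \<and> g e = e \<and> g f = f' \<and> (\<forall>u. B u e = 0 \<longrightarrow> B u f = 0 \<longrightarrow> g u = \<psi> u)"
  proof (rule isometry_from_hyp_pair[OF ef ef'])
    show "linear_map \<psi>"
      by (rule linear_mapI) (simp_all add: \<psi>_def form_simps
      vec.scale_left_distrib vec.scale_right_diff_distrib vec.scale_scale algebra_simps)
  next
    fix u assume u: "B u e = 0" "B u f = 0"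
    show "B (\<psi> u) e = 0 \<and> B (\<psi> u) f' = 0"
      using u by (simp add: \<psi>_def form_simps E E')
    have "q (u + (- B u f') *s e) = q u"
      using u q_scale[OF E(1), of "- B u f'"] by (subst q_add) (simp add: form_simps \<tau>_0)
    then show "q (\<psi> u) = q u"
      by (simp add: \<psi>_def)
    fix v assume v: "B v e = 0" "B v f = 0"
    then show "B (\<psi> u) (\<psi> v) = B u v"
      using u orth_sym[of v e] by (simp add: \<psi>_def form_simps E)
  qed
  then show ?thesis
    using P unfolding hyp_equiv_def orth_to_def \<psi>_def by fastforce
qed

text \<open>Glued from the identity on the complement.\<close>

lemma hyp_equiv_swap:
  assumes ef: "hyp_pair e f" and ef': "hyp_pair (c *s f) (d *s e)"
    and P: "orth_to P e" "orth_to P f"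
  shows "hyp_equiv P e f (c *s f) (d *s e)"
proof -
  have "\<exists>g. isometry g \<and> g e = c *s f \<and> g f = d *s e \<and> (\<forall>u. B u e = 0 \<longrightarrow> B u f = 0 \<longrightarrow> g u = id u)"
    by (rule isometry_from_hyp_pair[OF ef ef']) (simp_all add: vec.linear_id[unfolded id_def] form_simps)
  then show ?thesis
    using P unfolding hyp_equiv_def orth_to_def by fastforce
qed

lemma hyp_pair_scale:
  assumes "q e = 0" "q f = 0" "B e f \<noteq> 0"
  shows "hyp_pair e (\<sigma> (inverse (B e f)) *s f)"
  using assms unfolding hyp_pair_def by (simp add: q_scale form_simps \<sigma>_\<sigma>)

text \<open>As \<open>e\<close> and \<open>e'\<close> are not orthogonal, each has a multiple of the
  other as a partner. The route is \<open>(e, f)\<close>, \<open>(e, x *s e')\<close>,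
  \<open>(e', y *s e)\<close>, \<open>(e', f')\<close>: change the partner, swap, change the
  partner.\<close>

lemma hyp_equiv_linked:
  assumes ef: "hyp_pair e f" and ef': "hyp_pair e' f'" and link: "B e e' \<noteq> 0"
    and P: "orth_to P e" "orth_to P f" "orth_to P e'" "orth_to P f'"
  shows "hyp_equiv P e f e' f'"
proof -
  define x where "x = \<sigma> (inverse (B e e'))"
  define y where "y = \<sigma> (inverse (B e' e))"
  have x0: "x \<noteq> 0"
    using link unfolding x_def by simp
  have 1: "hyp_pair e (x *s e')"
    using hyp_pair_scale[of e e'] ef ef' link unfolding x_def hyp_pair_def by blast
  have 2: "hyp_pair e' (y *s e)"
    using hyp_pair_scale[of e' e] ef ef' link orth_sym[of e' e] unfolding y_def hyp_pair_def by blast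
  have "hyp_equiv P e f e (x *s e')"
    using hyp_equiv_same_left[OF ef 1] P by (simp add: orth_to_simps)
  moreover have "hyp_equiv P e (x *s e') e' (y *s e)"
    using hyp_equiv_swap[OF 1, of "inverse x" y P] P x0 2
    by (simp add: orth_to_simps vec.scale_scale)
  moreover have "hyp_equiv P e' (y *s e) e' f'"
    using hyp_equiv_same_left[OF 2 ef'] P by (simp add: orth_to_simps)
  ultimately show ?thesis
    using hyp_equiv_trans by blast
qed

lemma hyp_pair_swap: "hyp_pair e f \<Longrightarrow> hyp_pair f (\<epsilon> *s e)"
  by (simp add: hyp_pair_def[of f] q_scale hyp_pair_simps[of e f] scale_right \<sigma>_\<epsilon> \<epsilon>_\<epsilon>)

text \<open>Exchanging the members of either pair, up to the sign \<open>\<epsilon>\<close>, reduces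
  to the linked case as soon as one of \<open>e\<close>, \<open>f\<close> fails to be orthogonal to
  one of \<open>e'\<close>, \<open>f'\<close>. The remaining case takes a detour through an
  intermediate pair.\<close>

lemma hyp_equiv_all:
  assumes ef: "hyp_pair e f" and ef': "hyp_pair e' f'"
    and P: "orth_to P e" "orth_to P f" "orth_to P e'" "orth_to P f'"
  shows "hyp_equiv P e f e' f'"
proof -
  note E = hyp_pair_simps[OF ef] and E' = hyp_pair_simps[OF ef']
  note s = hyp_pair_swap[OF ef] and s' = hyp_pair_swap[OF ef']
  have sw: "hyp_equiv P e f f (\<epsilon> *s e)"
    by (rule hyp_equiv_linked[OF ef s _ P(1,2,2) orth_to_simps(2)[OF P(1)]]) (simp add: E)
  have sw': "hyp_equiv P f' (\<epsilon> *s e') e' f'"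
    by (rule hyp_equiv_linked[OF s' ef' _ P(4) orth_to_simps(2)[OF P(3)] P(3,4)]) (simp add: E')
  consider "B e e' \<noteq> 0" | "B f e' \<noteq> 0" | "B e f' \<noteq> 0" | "B f f' \<noteq> 0"
    | "B f e' = 0" "B e f' = 0" "B f f' = 0" by blast
  then show ?thesis
  proof cases
    case 1
    then show ?thesis using hyp_equiv_linked[OF ef ef' _ P] by blast
  next
    case 2
    show ?thesis
      by (rule hyp_equiv_trans[OF sw hyp_equiv_linked[OF s ef' 2]]) (simp_all add: P orth_to_simps(2))
  next
    case 3
    show ?thesis
      by (rule hyp_equiv_trans[OF hyp_equiv_linked[OF ef s' 3] sw']) (simp_all add: P orth_to_simps(2))
  next
    case 4
    show ?thesis
      by (rule hyp_equiv_trans[OF sw hyp_equiv_trans[OF hyp_equiv_linked[OF s s' 4] sw']])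
        (simp_all add: P orth_to_simps(2))
  next
    case 5
    \<comment> \<open>The vanishing products make \<open>f + f'\<close> singular; moreover
      \<open>B e ?g = 1\<close> and \<open>B ?g e' = \<epsilon>\<close>, so both halves of the
      detour are linked.\<close>
    let ?g = "f + f'"
    have g: "hyp_pair e ?g" "B ?g e' \<noteq> 0" "orth_to P ?g"
      by (simp_all add: hyp_pair_def q_add form_simps \<tau>_0 orth_to_simps 5 E E' P)
    note gs = hyp_pair_swap[OF g(1)]
    have "B e ?g \<noteq> 0"
      using g(1) by (simp only: hyp_pair_def) simp
    then have "hyp_equiv P e f ?g (\<epsilon> *s e)"
      by (rule hyp_equiv_linked[OF ef gs _ P(1,2) g(3) orth_to_simps(2)[OF P(1)]])
    moreover have "hyp_equiv P ?g (\<epsilon> *s e) e' f'"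
      by (rule hyp_equiv_linked[OF gs ef' g(2,3) orth_to_simps(2)[OF P(1)] P(3,4)])
    ultimately show ?thesis
      by (rule hyp_equiv_trans)
  qed
qed

section \<open>Transitivity of isometries on frames\<close>

definition hyp_frame :: "nat \<Rightarrow> (nat \<Rightarrow> 'a ^ 'n) \<Rightarrow> (nat \<Rightarrow> 'a ^ 'n) \<Rightarrow> bool" where
  "hyp_frame m e f \<longleftrightarrow> (\<forall>i<m. q (e i) = 0 \<and> q (f i) = 0) \<and>
     (\<forall>i<m. \<forall>j<m. B (e i) (e j) = 0 \<and> B (f i) (f j) = 0 \<and> B (e i) (f j) = (if i = j then 1 else 0))"

lemma hyp_frame_mono: "hyp_frame m e f \<Longrightarrow> l \<le> m \<Longrightarrow> hyp_frame l e f"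
  unfolding hyp_frame_def by auto

text \<open>Once the first \<open>m\<close> pairs are aligned, the image of the last pair and its
  target are both orthogonal to them, so an isometry that fixes these pairs can align the last
  one.\<close>

lemma hyp_frame_isometry:
  "hyp_frame m e f \<Longrightarrow> hyp_frame m e' f' \<Longrightarrow>
    \<exists>g. isometry g \<and> (\<forall>i<m. g (e i) = e' i \<and> g (f i) = f' i)"
proof (induction m)
  case 0
  then show ?case using isometry_id by auto
next
  case (Suc m)
  have "hyp_frame m e f" "hyp_frame m e' f'"
    using Suc.prems by (simp_all add: hyp_frame_mono[OF _ le_SucI[OF order_refl]])
  from Suc.IH[OF this] obtain g
    where g: "isometry g" "\<And>i. i < m \<Longrightarrow> g (e i) = e' i" "\<And>i. i < m \<Longrightarrow> g (f i) = f' i"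
    by auto
  have Bg: "B (g u) (g v) = B u v" and qg: "q (g v) = q v" for u v
    using g(1) unfolding isometry_def by auto
  let ?P = "e' ` {..<m} \<union> f' ` {..<m}"
  have orth: "B (e i) (e m) = 0 \<and> B (f i) (e m) = 0 \<and> B (e i) (f m) = 0 \<and> B (f i) (f m) = 0"
    if fr: "hyp_frame (Suc m) e f" and i: "i < m" for e f i
  proof -
    have "i < Suc m" "m < Suc m" "i \<noteq> m" using i by auto
    then show ?thesis
      using fr orth_sym[of "e m" "f i"] unfolding hyp_frame_def by simp
  qed
  have "hyp_pair (e' m) (f' m)"
    using Suc.prems(2) unfolding hyp_frame_def hyp_pair_def by simp
  moreover have "hyp_pair (g (e m)) (g (f m))"
    using Suc.prems(1) unfolding hyp_frame_def hyp_pair_def by (simp add: Bg qg)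
  moreover have "orth_to ?P (e' m)" "orth_to ?P (f' m)"
    using orth[OF Suc.prems(2)] by (simp_all add: orth_to_def ball_Un)
  moreover have "B (e' i) (g (e m)) = 0 \<and> B (f' i) (g (e m)) = 0 \<and>
      B (e' i) (g (f m)) = 0 \<and> B (f' i) (g (f m)) = 0" if "i < m" for i
    using orth[OF Suc.prems(1) that] Bg[of "e i"] Bg[of "f i"] g(2)[OF that] g(3)[OF that] by simp
  then have "orth_to ?P (g (e m))" "orth_to ?P (g (f m))"
    by (simp_all add: orth_to_def ball_Un)
  ultimately have "hyp_equiv ?P (g (e m)) (g (f m)) (e' m) (f' m)"
    by (intro hyp_equiv_all)
  then obtain h where h: "isometry h" "h (g (e m)) = e' m" "h (g (f m)) = f' m" "\<forall>u\<in>?P. h u = u"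
    unfolding hyp_equiv_def by blast
  have "isometry (h \<circ> g)"
    using g(1) h(1) isometry_compose by blast
  moreover have "(h \<circ> g) (e i) = e' i \<and> (h \<circ> g) (f i) = f' i" if "i < Suc m" for i
    using that g h by (cases "i = m") auto
  ultimately show ?case by blast
qed


subsection \<open>Singular subspaces and hyperbolic frames\<close>

lemma span_orth:
  assumes "\<And>s. s \<in> S \<Longrightarrow> B s v = 0" "u \<in> vec.span S"
  shows "B u v = 0"
  using assms(2) by (induction u rule: vec.span_induct_alt) (simp_all add: form_simps assms(1))

lemma span_orth_span:
  assumes "\<And>s t. s \<in> S \<Longrightarrow> t \<in> T \<Longrightarrow> B s t = 0" "u \<in> vec.span S" "v \<in> vec.span T"
  shows "B u v = 0"
proof -
  have "B t u = 0" if "t \<in> T" for t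
    using span_orth[OF assms(1)[OF _ that] assms(2)] orth_sym[of t u] by blast
  then show ?thesis
    using span_orth[OF _ assms(3)] orth_sym[of u v] by blast
qed

lemma singular_span:
  assumes S: "\<And>s. s \<in> S \<Longrightarrow> q s = 0" "\<And>s t. s \<in> S \<Longrightarrow> t \<in> S \<Longrightarrow> B s t = 0"
  shows "singular K B Q (vec.span S)"
proof -
  have B0: "B u v = 0" if "u \<in> vec.span S" "v \<in> vec.span S" for u v
    using span_orth_span[OF S(2)] that by blast
  have "u \<in> vec.span S \<and> q u = 0" if "u \<in> vec.span S" for u
    using that
  proof (induction u rule: vec.span_induct_alt)
    case (step c x y)
    then have "x \<in> vec.span S" "c *s x \<in> vec.span S"
      by (auto intro: vec.span_base vec.span_scale)
    then show ?case
      using step B0[of "c *s x" y] by (simp add: q_add q_scale[OF S(1)] \<tau>_0 vec.span_add)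
  qed (simp add: vec.span_zero)
  then show ?thesis
    using B0 by (simp add: singular_iff)
qed

lemma singularD:
  assumes "singular K B Q U"
  shows "vec.subspace U" "\<And>u. u \<in> U \<Longrightarrow> q u = 0" "\<And>u v. u \<in> U \<Longrightarrow> v \<in> U \<Longrightarrow> B u v = 0"
  using assms by (auto simp: singular_iff)

section \<open>Witt index and completion of singular bases to frames\<close>

abbreviation \<omega> :: nat where "\<omega> \<equiv> witt_index K B Q"

lemma finite_singular_dims: "finite {vec.dim U | U. singular K B Q U}"
proof (rule finite_subset)
  show "{vec.dim U | U. singular K B Q U} \<subseteq> {..vec.dim (UNIV :: ('a ^ 'n) set)}"
  proof clarify
    fix U :: "('a ^ 'n) set"
    show "vec.dim U \<le> vec.dim (UNIV :: ('a ^ 'n) set)"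
      by (rule vec.dim_subset[OF subset_UNIV])
  qed
qed (rule finite_atMost)

lemma singular_dim_le: "singular K B Q U \<Longrightarrow> vec.dim U \<le> \<omega>"
  unfolding witt_index_def by (rule Max_ge[OF finite_singular_dims]) blast

lemma max_singular_exists: "\<exists>U. singular K B Q U \<and> vec.dim U = \<omega>"
proof -
  have "singular K B Q (vec.span {})"
    by (rule singular_span) auto
  then have "\<omega> \<in> {vec.dim U | U. singular K B Q U}"
    unfolding witt_index_def by (intro Max_in[OF finite_singular_dims]) blast
  then show ?thesis by fastforce
qed

text \<open>Duality for the functionals \<open>B s\<close>. The conclusion equates functionals
  rather than vectors because \<open>B\<close> may have a radical.\<close>

lemma functional_in_span:
  assumes "finite S" "\<And>w. (\<And>s. s \<in> S \<Longrightarrow> B s w = 0) \<Longrightarrow> B e w = 0"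
  shows "\<exists>x\<in>vec.span S. \<forall>w. B e w = B x w"
  using assms
proof (induction S arbitrary: e rule: finite_induct)
  case empty
  then show ?case by simp
next
  case (insert s S)
  show ?case
  proof (cases "\<forall>w. (\<forall>t\<in>S. B t w = 0) \<longrightarrow> B s w = 0")
    case True
    then have "\<exists>x\<in>vec.span S. \<forall>w. B e w = B x w"
      by (intro insert.IH insert.prems) auto
    then show ?thesis
      using vec.span_mono[of S "insert s S"] by blast
  next
    case False
    then obtain w0 where w0: "\<And>t. t \<in> S \<Longrightarrow> B t w0 = 0" "B s w0 \<noteq> 0" by blast
    \<comment> \<open>\<open>c\<close> makes \<open>e - c *s s\<close> annihilate the separating
      vector \<open>w0\<close>. The \<open>\<sigma>\<close> in \<open>d\<close> below compensates
      for the semilinearity of \<open>B\<close> in its second argument.\<close>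
    define c where "c = B e w0 / B s w0"
    have "B (e - c *s s) w = 0" if w: "\<And>t. t \<in> S \<Longrightarrow> B t w = 0" for w
    proof -
      define d where "d = \<sigma> (B s w / B s w0)"
      have "B e (w - d *s w0) = 0"
        using w w0 by (intro insert.prems) (auto simp: d_def form_simps \<sigma>_\<sigma>)
      then show ?thesis
        using w0(2) by (simp add: form_simps c_def d_def \<sigma>_\<sigma> field_simps)
    qed
    then obtain x where x: "x \<in> vec.span S" "\<And>w. B (e - c *s s) w = B x w"
      using insert.IH[of "e - c *s s"] by blast
    have "B e w = B (x + c *s s) w" for w
      using x(2)[of w] by (simp add: form_simps algebra_simps)
    moreover have "x + c *s s \<in> vec.span (insert s S)"
    proof (rule vec.span_add)
      show "x \<in> vec.span (insert s S)"
        using x(1) vec.span_mono[of S "insert s S"] by blast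
    qed (simp add: vec.span_scale vec.span_base)
    ultimately show ?thesis by blast
  qed
qed

text \<open>Interpolates between a basis of a singular subspace (\<open>l = 0\<close>) and a
  hyperbolic frame (\<open>l = m\<close>). Independence is part of it, since the form does not
  separate vectors \<open>e i\<close> that have no partner yet.\<close>

definition partial_frame :: "nat \<Rightarrow> nat \<Rightarrow> (nat \<Rightarrow> 'a ^ 'n) \<Rightarrow> (nat \<Rightarrow> 'a ^ 'n) \<Rightarrow> bool" where
  "partial_frame m l e f \<longleftrightarrow> inj_on e {..<m} \<and> vec.independent (e ` {..<m}) \<and>
     (\<forall>i<m. q (e i) = 0) \<and> (\<forall>i<l. q (f i) = 0) \<and> (\<forall>i<m. \<forall>j<m. B (e i) (e j) = 0) \<and>
     (\<forall>i<l. \<forall>j<l. B (f i) (f j) = 0) \<and> (\<forall>i<m. \<forall>j<l. B (e i) (f j) = (if i = j then 1 else 0))"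

text \<open>A vector with the right products against all \<open>e i\<close> is corrected twice: to
  become orthogonal to the earlier \<open>f j\<close>, then to become singular. Both corrections add
  combinations of the mutually orthogonal \<open>e i\<close>, so the products with the
  \<open>e i\<close> survive.\<close>

lemma partial_frame_step:
  assumes "partial_frame m l e f" "l < m"
  shows "\<exists>g. q g = 0 \<and> (\<forall>j<l. B (f j) g = 0) \<and> (\<forall>i<m. B (e i) g = (if i = l then 1 else 0))"
proof -
  have inj: "inj_on e {..<m}" and ind: "vec.independent (e ` {..<m})"
    and qe: "\<And>i. i < m \<Longrightarrow> q (e i) = 0"
    and ee: "\<And>i j. i < m \<Longrightarrow> j < m \<Longrightarrow> B (e i) (e j) = 0"
    and ef: "\<And>i j. i < m \<Longrightarrow> j < l \<Longrightarrow> B (e i) (f j) = (if i = j then 1 else 0)"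
    using assms(1) unfolding partial_frame_def by auto
  define S where "S = e ` ({..<m} - {l})"
  have S: "S = e ` {..<m} - {e l}"
    using inj assms(2) unfolding S_def by (auto simp: inj_on_def)
  have notin: "e l \<notin> vec.span S"
    using ind assms(2) unfolding S vec.dependent_def by auto
  \<comment> \<open>Otherwise \<open>e l\<close> and some \<open>x\<close> in the span of the other
    vectors define the same functional; then \<open>e l - x\<close> is singular and orthogonal to
    everything, hence zero, against independence.\<close>
  have "\<exists>w. (\<forall>s\<in>S. B s w = 0) \<and> B (e l) w \<noteq> 0"
  proof (rule ccontr)
    assume "\<not> ?thesis"
    then obtain x where x: "x \<in> vec.span S" "\<And>w. B (e l) w = B x w"
      using functional_in_span[of S "e l"] unfolding S_def by blast
    have "singular K B Q (vec.span (e ` {..<m}))"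
      by (rule singular_span) (auto simp: qe ee)
    moreover have "e l - x \<in> vec.span (e ` {..<m})"
      using x(1) assms(2) vec.span_mono[of S "e ` {..<m}"] unfolding S
      by (intro vec.span_diff) (auto intro: vec.span_base)
    ultimately have "q (e l - x) = 0"
      by (rule singularD(2))
    then have "e l - x = 0"
      by (rule nondeg) (simp add: diff_left x(2))
    then show False
      using notin x(1) by simp
  qed
  then obtain w0 where w0: "\<And>s. s \<in> S \<Longrightarrow> B s w0 = 0" "B (e l) w0 \<noteq> 0" by blast
  define w1 where "w1 = \<sigma> (inverse (B (e l) w0)) *s w0"
  have w1: "B (e i) w1 = (if i = l then 1 else 0)" if "i < m" for i
    using w0 that unfolding w1_def S_def by (auto simp: form_simps \<sigma>_\<sigma>)
  define z where "z = (\<Sum>j<l. B w1 (f j) *s e j)"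
  have z: "B z (f j) = B w1 (f j)" if "j < l" for j
  proof -
    have "B z (f j) = (\<Sum>i<l. if i = j then B w1 (f i) else 0)"
      unfolding z_def sum_left by (rule sum.cong) (use that assms(2) in \<open>auto simp: scale_left ef\<close>)
    then show ?thesis
      using that by simp
  qed
  have ze: "B z (e i) = 0" if "i < m" for i
    unfolding z_def using that assms(2) by (auto simp: sum_left scale_left ee intro!: sum.neutral)
  define w2 where "w2 = w1 - z"
  have w2f: "B w2 (f j) = 0" if "j < l" for j
    using z[OF that] by (simp add: w2_def diff_left)
  have w2e: "B (e i) w2 = (if i = l then 1 else 0)" if "i < m" for i
    using w1[OF that] ze[OF that] orth_sym[of z "e i"] by (simp add: w2_def diff_right)
  obtain a where a: "q w2 + \<tau> a = 0"
    using \<tau>_onto by blast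
  \<comment> \<open>Adding \<open>c *s e l\<close> changes \<open>q\<close> by
    \<open>\<tau> (B w2 (c *s e l))\<close>. As \<open>B w2 (e l) = \<epsilon>\<close>, this
    \<open>c\<close> makes the product equal to \<open>a\<close>, and \<open>\<tau> a\<close>
    cancels \<open>q w2\<close>.\<close>
  define c where "c = \<sigma> (a * \<epsilon>)"
  define g where "g = w2 + c *s e l"
  have "B w2 (e l) = \<epsilon>"
    using w2e[OF assms(2)] swap[of w2 "e l"] by simp
  then have "B w2 (c *s e l) = a"
    unfolding c_def using \<epsilon>_\<epsilon> by (simp add: scale_right \<sigma>_\<sigma> mult.assoc)
  moreover have "q (c *s e l) = 0"
    by (rule q_scale[OF qe[OF assms(2)]])
  ultimately have "q g = 0"
    using a by (simp add: g_def q_add)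
  moreover have "B (f j) g = 0" if "j < l" for j
    using w2f[OF that] ef[OF assms(2) that] that orth_sym[of "f j" g]
    by (simp add: g_def add_left scale_left)
  moreover have "B (e i) g = (if i = l then 1 else 0)" if "i < m" for i
    using w2e[OF that] ee[OF that assms(2)] by (simp add: g_def add_right scale_right)
  ultimately show ?thesis by blast
qed

text \<open>The prescribed partners survive. This matters for geodesics, whose later vertices
  dictate some of them.\<close>

lemma partial_frame_extend:
  assumes "partial_frame m l e f" "l \<le> m"
  shows "\<exists>f'. hyp_frame m e f' \<and> (\<forall>i<l. f' i = f i)"
  using assms(2,1)
proof (induction l arbitrary: f rule: inc_induct)
  case base
  then show ?case
    unfolding partial_frame_def hyp_frame_def by auto
next
  case (step l)
  obtain g where g: "q g = 0" "\<And>j. j < l \<Longrightarrow> B (f j) g = 0"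
    "\<And>i. i < m \<Longrightarrow> B (e i) g = (if i = l then 1 else 0)"
    using partial_frame_step[OF step.prems step.hyps(2)] by blast
  have "B g (f j) = 0" if "j < l" for j
    using g(2)[OF that] orth_sym[of g] by blast
  then have "partial_frame m (Suc l) e (f(l := g))"
    using step.prems g q_isotropic[OF g(1)] unfolding partial_frame_def by (auto simp: less_Suc_eq)
  then obtain f' where "hyp_frame m e f'" "\<forall>i<Suc l. f' i = (f(l := g)) i"
    using step.IH by blast
  then show ?case
    by (intro exI[of _ f']) auto
qed

section \<open>Subspaces spanned by parts of a frame\<close>

lemma hyp_frameD:
  assumes "hyp_frame m e f" "i < m"
  shows "q (e i) = 0" "q (f i) = 0"
    "\<And>j. j < m \<Longrightarrow> B (e i) (e j) = 0" "\<And>j. j < m \<Longrightarrow> B (f i) (f j) = 0"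
    "\<And>j. j < m \<Longrightarrow> B (e i) (f j) = (if i = j then 1 else 0)"
    "\<And>j. j < m \<Longrightarrow> B (f i) (e j) = (if i = j then \<epsilon> else 0)"
  using assms swap[of "f i"] unfolding hyp_frame_def by auto

text \<open>Each \<open>e i\<close> is detected by its product with \<open>f i\<close>, and each
  \<open>f i\<close> by its product with \<open>e i\<close>, because the other vectors of the family
  are orthogonal to the detecting one.\<close>

lemma hyp_frame_independent:
  assumes fr: "hyp_frame m e f" and I: "I \<subseteq> {..<m}" and J: "J \<subseteq> {..<m}"
  shows "vec.independent (e ` I \<union> f ` J)" "inj_on e I" "inj_on f J" "e ` I \<inter> f ` J = {}"
proof -
  note D = hyp_frameD[OF fr]
  have lt: "i < m" if "i \<in> I \<or> i \<in> J" for i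
    using that I J by auto
  have ne: "e i \<noteq> f j" if "i \<in> I" "j \<in> J" for i j
  proof
    assume "e i = f j"
    then have "B (e i) (f i) = B (f j) (f i)" by simp
    then show False
      using that D lt by simp
  qed
  then show "e ` I \<inter> f ` J = {}" by auto
  show "inj_on e I"
  proof (rule inj_onI, rule ccontr)
    fix i j assume ij: "i \<in> I" "j \<in> I" "e i = e j" "i \<noteq> j"
    have "B (e i) (f i) = 1" "B (e j) (f i) = 0"
      using D lt ij(1,2,4) by simp_all
    then show False
      using ij(3) by simp
  qed
  show "inj_on f J"
  proof (rule inj_onI, rule ccontr)
    fix i j assume ij: "i \<in> J" "j \<in> J" "f i = f j" "i \<noteq> j"
    have "B (f i) (e i) = \<epsilon>" "B (f j) (e i) = 0"
      using D lt ij(1,2,4) by simp_all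
    then show False
      using ij(3) by simp
  qed
  show "vec.independent (e ` I \<union> f ` J)"
    unfolding vec.dependent_def
  proof (safe)
    fix i assume i: "i \<in> I" "e i \<in> vec.span (e ` I \<union> f ` J - {e i})"
    have "B s (f i) = 0" if "s \<in> e ` I \<union> f ` J - {e i}" for s
      using that D lt i by auto
    then have "B (e i) (f i) = 0"
      using span_orth i(2) by blast
    then show False
      using D lt i by simp
  next
    fix i assume i: "i \<in> J" "f i \<in> vec.span (e ` I \<union> f ` J - {f i})"
    have "B s (e i) = 0" if "s \<in> e ` I \<union> f ` J - {f i}" for s
      using that D lt i by auto
    then have "B (f i) (e i) = 0"
      using span_orth i(2) by blast
    then show False
      using D lt i by simp
  qed
qed

abbreviation frame_span :: "(nat \<Rightarrow> 'a ^ 'n) \<Rightarrow> (nat \<Rightarrow> 'a ^ 'n) \<Rightarrow> nat set \<Rightarrow> nat set \<Rightarrow> ('a ^ 'n) set" where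
  "frame_span e f I J \<equiv> vec.span (e ` I \<union> f ` J)"

lemma frame_span_dim:
  assumes fr: "hyp_frame m e f" and I: "I \<subseteq> {..<m}" and J: "J \<subseteq> {..<m}"
  shows "vec.dim (frame_span e f I J) = card I + card J"
proof -
  note ind = hyp_frame_independent[OF assms]
  have "finite I" "finite J"
    using I J finite_subset by auto
  then have "card (e ` I \<union> f ` J) = card I + card J"
    using ind by (simp add: card_Un_disjoint card_image)
  then show ?thesis
    using vec.dim_span_eq_card_independent[OF ind(1)] by simp
qed

lemma frame_span_singular:
  assumes fr: "hyp_frame m e f" and I: "I \<subseteq> {..<m}" and J: "J \<subseteq> {..<m}" and "I \<inter> J = {}"
  shows "singular K B Q (frame_span e f I J)"
proof (rule singular_span)
  have lt: "i < m" if "i \<in> I \<or> i \<in> J" for i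
    using that I J by auto
  show "q s = 0" if "s \<in> e ` I \<union> f ` J" for s
    using that hyp_frameD[OF fr] lt by auto
  show "B s t = 0" if "s \<in> e ` I \<union> f ` J" "t \<in> e ` I \<union> f ` J" for s t
    using that hyp_frameD[OF fr] lt assms(4) by auto
qed

lemma frame_span_vertex:
  assumes "hyp_frame m e f" "I \<subseteq> {..<m}" "J \<subseteq> {..<m}" "I \<inter> J = {}" "card I + card J = k"
  shows "frame_span e f I J \<in> pg_vertices K B Q k"
  using frame_span_dim[OF assms(1-3)] frame_span_singular[OF assms(1-4)] assms(5)
  unfolding pg_vertices_def by simp

lemma hyp_frame_exists: "\<exists>e f. hyp_frame \<omega> e f"
proof -
  obtain U where U: "singular K B Q U" "vec.dim U = \<omega>"
    using max_singular_exists by blast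
  obtain b where b: "b \<subseteq> U" "vec.independent b" "card b = vec.dim U"
    using vec.basis_exists[of U] by metis
  have "finite b"
    using b(2) vec.finiteI_independent by blast
  then obtain e where e: "bij_betw e {..<\<omega>} b"
    using ex_bij_betw_nat_finite[of b] U b by (auto simp: atLeast0LessThan)
  then have "e i \<in> U" if "i < \<omega>" for i
    using that b by (auto simp: bij_betw_def)
  \<comment> \<open>With \<open>l = 0\<close> there are no partners yet; the second \<open>e\<close>
    is a placeholder.\<close>
  then have "partial_frame \<omega> 0 e e"
    using e b U unfolding partial_frame_def by (auto simp: bij_betw_def singular_iff)
  then show ?thesis
    using partial_frame_extend by blast
qed

section \<open>Action of isometries on the Grassmann graph\<close>

lemma subspace_sum_eq_span: 
  assumes "vec.subspace U" "vec.subspace W"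
  shows "subspace_sum U W = vec.span (U \<union> W)"
  using assms by (simp add: subspace_sum_def vec.span_Un vec.span_eq_iff[THEN iffD2])

lemma dim_subspace_sum:
  assumes "vec.subspace U" "vec.subspace W"
  shows "vec.dim (subspace_sum U W) + vec.dim (U \<inter> W) = vec.dim U + vec.dim W"
  using vec.dim_sums_Int[OF assms] by (simp add: subspace_sum_def conj_commute Collect_conj_eq)

lemma isometry_image_simps:
  assumes "isometry g"
  shows "vec.dim (g ` U) = vec.dim U" "singular K B Q (g ` U) \<longleftrightarrow> singular K B Q U"
    "g ` (U \<inter> W) = g ` U \<inter> g ` W" "subspace_sum (g ` U) (g ` W) = g ` subspace_sum U W"
    "g ` U = g ` W \<longleftrightarrow> U = W" "g ` frame_span e f I J = frame_span (g \<circ> e) (g \<circ> f) I J"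
proof -
  have lin: "linear_map g" and B: "B (g u) (g v) = B u v" and q: "q (g v) = q v" for u v
    using assms unfolding isometry_def by auto
  have bij: "bij g" and inj: "inj g"
    using isometry_bij[OF assms] by (auto simp: bij_def)
  show "vec.dim (g ` U) = vec.dim U"
    using vec.dim_image_eq[OF lin] inj inj_on_subset by blast
  have sub: "vec.subspace (g ` U) \<longleftrightarrow> vec.subspace U"
  proof
    assume "vec.subspace (g ` U)"
    then have "vec.subspace (g -` (g ` U))"
      by (rule vec.linear_subspace_vimage[OF lin])
    then show "vec.subspace U"
      using inj by (simp add: inj_vimage_image_eq)
  qed (rule vec.linear_subspace_image[OF lin])
  then show "singular K B Q (g ` U) \<longleftrightarrow> singular K B Q U"
    by (simp add: singular_iff B q)
  show "g ` (U \<inter> W) = g ` U \<inter> g ` W"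
    using inj by (rule image_Int)
  have "{g u + g w |u w. u \<in> U \<and> w \<in> W} = g ` {u + w |u w. u \<in> U \<and> w \<in> W}"
    using vec.linear_add[OF lin] by (auto simp: image_iff) metis+
  then show "subspace_sum (g ` U) (g ` W) = g ` subspace_sum U W"
    unfolding subspace_sum_def by (smt (verit) Collect_cong image_iff)
  show "g ` U = g ` W \<longleftrightarrow> U = W"
    using inj by (rule inj_image_eq_iff)
  show "g ` frame_span e f I J = frame_span (g \<circ> e) (g \<circ> f) I J"
    using vec.linear_span_image[OF lin, of "e ` I \<union> f ` J"] by (simp add: image_Un image_comp)
qed

lemma isometry_graph_aut:
  assumes g: "isometry g"
  shows "graph_aut (pg_vertices K B Q k) (pg_adj K B Q k) ((`) g)"
  unfolding graph_aut_def
proof (intro conjI ballI)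
  note simps = isometry_image_simps[OF g]
  have surj: "g ` (g -` U) = U" for U
    using isometry_bij[OF g] by (simp add: bij_is_surj surj_image_vimage_eq)
  have "U \<in> (`) g ` pg_vertices K B Q k" if "U \<in> pg_vertices K B Q k" for U
    using that simps(1,2)[of "g -` U"] surj[of U] unfolding pg_vertices_def
    by (intro image_eqI[of _ _ "g -` U"]) auto
  then show "bij_betw ((`) g) (pg_vertices K B Q k) (pg_vertices K B Q k)"
    unfolding bij_betw_def by (auto simp: inj_on_def simps pg_vertices_def)
  show "pg_adj K B Q k U W \<longleftrightarrow> pg_adj K B Q k (g ` U) (g ` W)" for U W
    unfolding pg_adj_def by (simp add: simps(1,2,4,5) flip: simps(3))
qed


subsection \<open>Singular subspaces of intermediate dimension\<close>

lemma pg_verticesD: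
  assumes "U \<in> pg_vertices K B Q k"
  shows "singular K B Q U" "vec.subspace U" "vec.dim U = k" "\<And>u. u \<in> U \<Longrightarrow> q u = 0"
    "\<And>u v. u \<in> U \<Longrightarrow> v \<in> U \<Longrightarrow> B u v = 0"
  using assms unfolding pg_vertices_def singular_iff by auto

text \<open>The dimension formula trades the sum for the intersection. The \<open>Suc\<close> form
  already excludes \<open>U = W\<close>, and orthogonality of vectors is what the neighbour counts
  use.\<close>

lemma pg_adj_iff:
  assumes k: "k < \<omega>" and U: "U \<in> pg_vertices K B Q k" and W: "W \<in> pg_vertices K B Q k"
  shows "pg_adj K B Q k U W \<longleftrightarrow> k = Suc (vec.dim (U \<inter> W)) \<and> (\<forall>u\<in>U. \<forall>w\<in>W. B u w = 0)"
proof -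
  note U = pg_verticesD[OF U] and W = pg_verticesD[OF W]
  have sum: "subspace_sum U W = vec.span (U \<union> W)"
    by (rule subspace_sum_eq_span[OF U(2) W(2)])
  have dim: "vec.dim (subspace_sum U W) + vec.dim (U \<inter> W) = k + k"
    using dim_subspace_sum[OF U(2) W(2)] U(3) W(3) by simp
  have orth: "singular K B Q (subspace_sum U W) \<longleftrightarrow> (\<forall>u\<in>U. \<forall>w\<in>W. B u w = 0)"
  proof
    assume "singular K B Q (subspace_sum U W)"
    then show "\<forall>u\<in>U. \<forall>w\<in>W. B u w = 0"
      using singularD(3)[of "vec.span (U \<union> W)"] unfolding sum by (meson UnI1 UnI2 vec.span_base)
  next
    assume "\<forall>u\<in>U. \<forall>w\<in>W. B u w = 0"
    then show "singular K B Q (subspace_sum U W)"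
      unfolding sum using U(4,5) W(4,5) orth_sym by (intro singular_span) blast+
  qed
  have "vec.dim (U \<inter> W) = k" if "U = W"
    using that U(3) by simp
  then have "k = Suc (vec.dim (U \<inter> W)) \<longrightarrow> U \<noteq> W"
    by (metis n_not_Suc_n)
  moreover have "vec.dim (subspace_sum U W) = k + 1 \<longleftrightarrow> k = Suc (vec.dim (U \<inter> W))"
    using dim by linarith
  moreover have "k \<noteq> \<omega>"
    using k by simp
  ultimately show ?thesis
    unfolding pg_adj_def orth by argo
qed

lemma frame_span_sum:
  "subspace_sum (frame_span e f I J) (frame_span e f I' J') = frame_span e f (I \<union> I') (J \<union> J')"
proof -
  have "e ` (I \<union> I') \<union> f ` (J \<union> J') = (e ` I \<union> f ` J) \<union> (e ` I' \<union> f ` J')"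
    by (simp add: image_Un Un_ac)
  then show ?thesis
    by (simp only: subspace_sum_def vec.span_Un)
qed

lemma frame_span_adj:
  assumes fr: "hyp_frame \<omega> e f" and "k < \<omega>" and "frame_span e f I J \<in> pg_vertices K B Q k"
    and "I \<union> I' \<subseteq> {..<\<omega>}" "J \<union> J' \<subseteq> {..<\<omega>}" "(I \<union> I') \<inter> (J \<union> J') = {}"
    and card: "card (I \<union> I') + card (J \<union> J') = k + 1"
  shows "pg_adj K B Q k (frame_span e f I J) (frame_span e f I' J')"
proof -
  let ?U = "frame_span e f I J" and ?W = "frame_span e f I' J'"
  have dim: "vec.dim (subspace_sum ?U ?W) = k + 1"
    unfolding frame_span_sum using frame_span_dim[OF fr assms(4,5)] card by simp
  have "subspace_sum ?U ?U = ?U"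
    by (simp add: frame_span_sum)
  then have "?U \<noteq> ?W"
    using dim pg_verticesD(3)[OF assms(3)] by (metis Suc_eq_plus1 n_not_Suc_n)
  then show ?thesis
    unfolding pg_adj_def using dim assms(2) frame_span_singular[OF fr assms(4-6)]
    by (simp add: frame_span_sum)
qed

text \<open>The product with \<open>b\<close> reads off the coefficient of \<open>a\<close>.\<close>

lemma span_insert_orth:
  assumes "u \<in> vec.span (insert a S)" "B u b = 0" "B a b \<noteq> 0" "\<And>s. s \<in> S \<Longrightarrow> B s b = 0"
  shows "u \<in> vec.span S"
proof -
  obtain c where c: "u - c *s a \<in> vec.span S"
    using vec.span_breakdown_eq[of u a S] assms(1) by blast
  have "B (u - c *s a) b = 0"
    using span_orth[OF assms(4) c] by simp
  then have "c = 0"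
    using assms(2,3) by (simp add: form_simps)
  then show ?thesis
    using c by simp
qed

text \<open>Two kinds of pairs at distance 2: \<open>X + e\<close>, \<open>X + f\<close> with \<open>X\<close> of dimension \<open>k - 1\<close> and
  \<open>(e, f)\<close> a hyperbolic pair have at least two common neighbours, whereas
  \<open>X + a + e\<close>, \<open>X + b + f\<close> with \<open>X\<close> of dimension \<open>k - 2\<close> and \<open>X + a + b\<close> singular and
  orthogonal to \<open>e\<close> and \<open>f\<close> have \<open>X + a + b\<close> as their only common neighbour.\<close>

lemma not_distance_regular_between:
  assumes k: "1 < k" "k < \<omega>"
  shows "\<not> (geodesic_transitive (pg_vertices K B Q k) (pg_adj K B Q k) \<or>
    distance_regular (pg_vertices K B Q k) (pg_adj K B Q k))"
proof
  let ?V = "pg_vertices K B Q k" and ?E = "pg_adj K B Q k"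
  assume reg: "geodesic_transitive ?V ?E \<or> distance_regular ?V ?E"
  obtain e f where fr: "hyp_frame \<omega> e f"
    using hyp_frame_exists by blast
  note D = hyp_frameD[OF fr]
  define p where "p = k - 2"
  have kp: "k = Suc (Suc p)"
    using k unfolding p_def by simp
  have less: "Suc (Suc p) < \<omega>"
    using k kp by simp
  \<comment> \<open>The pair \<open>(e, f)\<close> is \<open>e (Suc p)\<close>,
    \<open>f (Suc p)\<close>. For \<open>W1\<close> the common space \<open>X\<close> is spanned by
    the \<open>e i\<close> with \<open>i \<le> p\<close>; for \<open>W2\<close> by those with
    \<open>i < p\<close>, with \<open>a = e p\<close> and \<open>b = e k\<close>. The index
    \<open>k\<close> is available because \<open>k < \<omega>\<close>.\<close>
  define U where "U = frame_span e f {..<Suc (Suc p)} {}"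
  define W1 where "W1 = frame_span e f {..<Suc p} {Suc p}"
  define Z1 where "Z1 = frame_span e f (insert k {..<Suc p}) {}"
  define Z2 where "Z2 = frame_span e f {..<Suc p} {k}"
  define W2 where "W2 = frame_span e f (insert k {..<p}) {Suc p}"
  note defs = U_def W1_def Z1_def Z2_def W2_def
  have V: "U \<in> ?V" "W1 \<in> ?V" "Z1 \<in> ?V" "Z2 \<in> ?V" "W2 \<in> ?V"
    unfolding defs by (rule frame_span_vertex[OF fr]; use kp less in auto)+
  have sets: "insert k {..<Suc p} \<union> {..<Suc (Suc p)} = {..<Suc (Suc (Suc p))}"
    "{..<Suc (Suc p)} \<union> insert k {..<Suc p} = {..<Suc (Suc (Suc p))}"
    "{..<Suc p} \<union> {..<Suc (Suc p)} = {..<Suc (Suc p)}"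
    "{..<Suc (Suc p)} \<union> {..<Suc p} = {..<Suc (Suc p)}"
    "{..<Suc p} \<union> {..<p} = {..<Suc p}" "insert k {..<Suc p} \<union> {..<Suc p} = insert k {..<Suc p}"
    "insert k {..<Suc p} \<union> insert k {..<p} = insert k {..<Suc p}"
    using kp by auto
  have E: "?E U Z1" "?E Z1 W1" "?E U Z2" "?E Z2 W1" "?E Z1 W2"
    unfolding defs
    by (rule frame_span_adj[OF fr k(2) _ _ _ ]; (use V in \<open>simp only: defs\<close>)?;
        use kp less in \<open>auto simp: sets\<close>)+
  have memb: "e (Suc p) \<in> U" "f (Suc p) \<in> W1" "f (Suc p) \<in> W2"
    unfolding defs by (auto intro: vec.span_base)
  have ef: "B (e (Suc p)) (f (Suc p)) = 1"
    using D less by simp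
  have far: "U \<noteq> W \<and> \<not> ?E U W" if "W \<in> ?V" "f (Suc p) \<in> W" for W
    using pg_verticesD(5)[OF V(1) memb(1), of "f (Suc p)"] pg_adj_iff[OF k(2) V(1) that(1)]
      ef memb(1) that by auto
  have "graph_dist_is ?V ?E U W1 2"
    using graph_dist_is_2[OF V(1) V(2) V(3)] far[OF V(2) memb(2)] E by blast
  moreover have "graph_dist_is ?V ?E U W2 2"
    using graph_dist_is_2[OF V(1) V(5) V(3)] far[OF V(5) memb(3)] E by blast
  ultimately have card: "card {z\<in>?V. ?E U z \<and> z \<noteq> W1 \<and> ?E z W1} = card {z\<in>?V. ?E U z \<and> z \<noteq> W2 \<and> ?E z W2}"
    by (rule common_neighbours_card[OF reg])
  have "{z\<in>?V. ?E U z \<and> z \<noteq> W2 \<and> ?E z W2} = {Z1}"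
  proof (intro equalityI subsetI)
    fix Z assume "Z \<in> {Z1}"
    then show "Z \<in> {z\<in>?V. ?E U z \<and> z \<noteq> W2 \<and> ?E z W2}"
      using V E far[OF V(5) memb(3)] by blast
  next
    fix Z assume "Z \<in> {z\<in>?V. ?E U z \<and> z \<noteq> W2 \<and> ?E z W2}"
    then have Z: "Z \<in> ?V" "?E U Z" "?E Z W2" by auto
    note ZD = pg_verticesD[OF Z(1)] and UD = pg_verticesD[OF V(1)] and WD = pg_verticesD[OF V(5)]
    have UZ: "k = Suc (vec.dim (U \<inter> Z))" "\<And>u z. u \<in> U \<Longrightarrow> z \<in> Z \<Longrightarrow> B u z = 0"
      using Z(2) pg_adj_iff[OF k(2) V(1) Z(1)] by auto
    have ZW: "k = Suc (vec.dim (Z \<inter> W2))" "\<And>z w. z \<in> Z \<Longrightarrow> w \<in> W2 \<Longrightarrow> B z w = 0"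
      using Z(3) pg_adj_iff[OF k(2) Z(1) V(5)] by auto
    \<comment> \<open>Vectors of \<open>Z\<close> are orthogonal to \<open>f (Suc p)\<close>, an
      element of \<open>W2\<close>, which kills their \<open>e (Suc p)\<close> component. Since the
      intersection has dimension \<open>k - 1\<close>, it is determined; the same works for
      \<open>Z \<inter> W2\<close>.\<close>
    have "U \<inter> Z \<subseteq> frame_span e f {..<Suc p} {}"
    proof
      fix u assume u: "u \<in> U \<inter> Z"
      show "u \<in> frame_span e f {..<Suc p} {}"
      proof (rule span_insert_orth)
        show "u \<in> vec.span (insert (e (Suc p)) (e ` {..<Suc p} \<union> f ` {}))"
          using u unfolding U_def by (simp add: lessThan_Suc)
        show "B u (f (Suc p)) = 0"
          using ZW(2) u memb(3) by blast
      qed (use ef D less in auto)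
    qed
    moreover have "vec.dim (frame_span e f {..<Suc p} {}) = Suc p"
      using frame_span_dim[OF fr, of "{..<Suc p}" "{}"] less by simp
    ultimately have UZ_eq: "U \<inter> Z = frame_span e f {..<Suc p} {}"
      using UZ(1) kp UD(2) ZD(2) by (intro vec.subspace_dim_equal) (auto intro: vec.subspace_inter)
    have "Z \<inter> W2 \<subseteq> frame_span e f (insert k {..<p}) {}"
    proof
      fix u assume u: "u \<in> Z \<inter> W2"
      show "u \<in> frame_span e f (insert k {..<p}) {}"
      proof (rule span_insert_orth)
        show "u \<in> vec.span (insert (f (Suc p)) (e ` insert k {..<p} \<union> f ` {}))"
          using u unfolding W2_def by (simp add: insert_commute)
        show "B u (e (Suc p)) = 0"
          using UZ(2) u memb(1) orth_sym by blast
      qed (use D less kp in auto)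
    qed
    moreover have "vec.dim (frame_span e f (insert k {..<p}) {}) = Suc p"
      using frame_span_dim[OF fr, of "insert k {..<p}" "{}"] less kp by simp
    ultimately have ZW_eq: "Z \<inter> W2 = frame_span e f (insert k {..<p}) {}"
      using ZW(1) kp WD(2) ZD(2) by (intro vec.subspace_dim_equal) (auto intro: vec.subspace_inter)
    have "e i \<in> Z" if "i \<in> insert k {..<Suc p}" for i
    proof (cases "i = k")
      case True
      then have "e i \<in> Z \<inter> W2"
        unfolding ZW_eq by (auto intro: vec.span_base)
      then show ?thesis by simp
    next
      case False
      then have "e i \<in> U \<inter> Z"
        unfolding UZ_eq using that by (auto intro: vec.span_base)
      then show ?thesis by simp
    qed
    then have "Z1 \<subseteq> Z"
      unfolding Z1_def using ZD(2) by (intro vec.span_minimal) auto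
    then have "Z1 = Z"
      using ZD(2,3) pg_verticesD(2,3)[OF V(3)] by (intro vec.subspace_dim_equal) auto
    then show "Z \<in> {Z1}" by simp
  qed
  then have "card {z\<in>?V. ?E U z \<and> z \<noteq> W1 \<and> ?E z W1} = 1"
    using card by simp
  then obtain Z where "{z\<in>?V. ?E U z \<and> z \<noteq> W1 \<and> ?E z W1} = {Z}"
    by (rule card_1_singletonE)
  moreover have "Z1 \<in> {z\<in>?V. ?E U z \<and> z \<noteq> W1 \<and> ?E z W1}" "Z2 \<in> {z\<in>?V. ?E U z \<and> z \<noteq> W1 \<and> ?E z W1}"
    using V E far[OF V(2) memb(2)] by blast+
  ultimately have "Z1 = Z2"
    by simp
  moreover have "e k \<in> Z1" "f k \<in> Z2"
    unfolding defs by (auto intro: vec.span_base)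
  moreover have "B (e k) (f k) = 1"
    using D k by simp
  ultimately show False
    using pg_verticesD(5)[OF V(4), of "e k" "f k"] by simp
qed


subsection \<open>The polar graph\<close>

lemma isometry_hyp_frame: "isometry g \<Longrightarrow> hyp_frame m e f \<Longrightarrow> hyp_frame m (g \<circ> e) (g \<circ> f)"
  unfolding isometry_def hyp_frame_def by simp

text \<open>\<open>I\<close> and \<open>J\<close> are fixed before the geodesic, so an isometry
  matching two frames matches the geodesics entry by entry. The bound by \<open>m\<close> is there
  because the isometry is controlled on frame vectors only.\<close>

lemma geodesic_transitiveI:
  assumes "\<And>xs. is_geodesic (pg_vertices K B Q k) (pg_adj K B Q k) xs \<Longrightarrow>
      \<exists>e f. hyp_frame m e f \<and> (\<forall>j<length xs. I j \<union> J j \<subseteq> {..<m} \<and> xs ! j = frame_span e f (I j) (J j))"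
  shows "geodesic_transitive (pg_vertices K B Q k) (pg_adj K B Q k)"
  unfolding geodesic_transitive_def
proof (intro allI impI, elim conjE)
  fix xs ys
  assume xs: "is_geodesic (pg_vertices K B Q k) (pg_adj K B Q k) xs"
    and ys: "is_geodesic (pg_vertices K B Q k) (pg_adj K B Q k) ys"
    and len: "length xs = length ys"
  obtain e f where fr: "hyp_frame m e f"
    and IJ: "\<And>j. j < length xs \<Longrightarrow> I j \<union> J j \<subseteq> {..<m}"
    and nth_xs: "\<And>j. j < length xs \<Longrightarrow> xs ! j = frame_span e f (I j) (J j)"
    using assms[OF xs] by blast
  obtain e' f' where fr': "hyp_frame m e' f'"
    and nth_ys: "\<And>j. j < length ys \<Longrightarrow> ys ! j = frame_span e' f' (I j) (J j)"
    using assms[OF ys] by blast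
  obtain g where g: "isometry g" "\<And>i. i < m \<Longrightarrow> g (e i) = e' i" "\<And>i. i < m \<Longrightarrow> g (f i) = f' i"
    using hyp_frame_isometry[OF fr fr'] by blast
  have "g ` (xs ! j) = ys ! j" if "j < length xs" for j
  proof -
    have "(g \<circ> e) ` I j = e' ` I j" "(g \<circ> f) ` J j = f' ` J j"
      using IJ[OF that] g by (auto intro!: image_cong)
    then show ?thesis
      using that len by (simp add: nth_xs nth_ys isometry_image_simps(6)[OF g(1)])
  qed
  then have "map ((`) g) xs = ys"
    using len by (intro nth_equalityI) auto
  then show "\<exists>h. graph_aut (pg_vertices K B Q k) (pg_adj K B Q k) h \<and> map h xs = ys"
    using isometry_graph_aut[OF g(1)] by blast
qed

lemma geodesic_length:
  assumes "is_geodesic V E xs" "graph_dist_is V E (hd xs) (last xs) n"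
  shows "length xs = Suc n"
proof -
  have "xs \<noteq> []" "graph_dist_is V E (hd xs) (last xs) (length xs - 1)"
    using assms(1) unfolding is_geodesic_def is_walk_def by auto
  moreover have "length xs - 1 = n"
    using calculation(2) assms(2) by (rule graph_dist_is_unique)
  ultimately show ?thesis
    by (cases xs) auto
qed

section \<open>Points, collinearity and the diameter of the polar graph\<close>

lemma point_generator:
  assumes "U \<in> pg_vertices K B Q 1"
  shows "\<exists>a. a \<noteq> 0 \<and> q a = 0 \<and> U = vec.span {a}"
proof -
  note U = pg_verticesD[OF assms]
  obtain b where b: "b \<subseteq> U" "vec.independent b" "U \<subseteq> vec.span b" "card b = 1"
    using vec.basis_exists[of U] U(3) by metis
  then obtain a where a: "b = {a}"
    by (meson card_1_singletonE)
  have "U = vec.span {a}"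
    using b U(2) vec.span_minimal[of b U] unfolding a by blast
  moreover have "a \<noteq> 0" "q a = 0"
    using b(1,2) U(4)[of a] unfolding a by (simp_all add: vec.dependent_single)
  ultimately show ?thesis
    by blast
qed

lemma point_vertex: "a \<noteq> 0 \<Longrightarrow> q a = 0 \<Longrightarrow> vec.span {a} \<in> pg_vertices K B Q 1"
  unfolding pg_vertices_def using singular_span[of "{a}"] q_isotropic by simp

lemma point_adj:
  assumes "1 < \<omega>" "a \<noteq> 0" "q a = 0" "b \<noteq> 0" "q b = 0"
  shows "pg_adj K B Q 1 (vec.span {a}) (vec.span {b}) \<longleftrightarrow> vec.span {a} \<noteq> vec.span {b} \<and> B a b = 0"
proof -
  note V = point_vertex[OF assms(2,3)] point_vertex[OF assms(4,5)]
  let ?d = "vec.dim (vec.span {a} \<inter> vec.span {b})"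
  have "?d = 0 \<longleftrightarrow> vec.span {a} \<noteq> vec.span {b}"
  proof
    assume "vec.span {a} \<noteq> vec.span {b}"
    then have "vec.span {a} \<inter> vec.span {b} \<noteq> vec.span {a} \<or> vec.span {a} \<inter> vec.span {b} \<noteq> vec.span {b}"
      by blast
    moreover have "?d \<le> 1"
      using vec.dim_subset[of "vec.span {a} \<inter> vec.span {b}" "vec.span {a}"] pg_verticesD(3)[OF V(1)] by auto
    moreover have "vec.span {a} \<inter> vec.span {b} = vec.span {c}"
      if "?d = 1" "c = a \<or> c = b" for c
      using that pg_verticesD(2,3)[OF V(1)] pg_verticesD(2,3)[OF V(2)]
      by (intro vec.subspace_dim_equal) (auto intro: vec.subspace_inter)
    ultimately have "?d \<noteq> 1" by blast
    with \<open>?d \<le> 1\<close> show "?d = 0" by linarith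
  next
    show "?d = 0 \<Longrightarrow> vec.span {a} \<noteq> vec.span {b}"
      using pg_verticesD(3)[OF V(1)] by (metis Int_absorb zero_neq_one)
  qed
  moreover have "(\<forall>u\<in>vec.span {a}. \<forall>w\<in>vec.span {b}. B u w = 0) \<longleftrightarrow> B a b = 0"
    using span_orth_span[of "{a}" "{b}"] vec.span_base[of a "{a}"] vec.span_base[of b "{b}"]
    by auto
  ultimately show ?thesis
    using pg_adj_iff[OF assms(1) V] by auto
qed

text \<open>Some full frame exists; an isometry moves its first \<open>l\<close> pairs onto the
  given ones, and the remaining pairs come along.\<close>

lemma hyp_frame_extend:
  assumes "hyp_frame l e f" "l \<le> \<omega>"
  shows "\<exists>e' f'. hyp_frame \<omega> e' f' \<and> (\<forall>i<l. e' i = e i \<and> f' i = f i)"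
proof -
  obtain e0 f0 where fr: "hyp_frame \<omega> e0 f0"
    using hyp_frame_exists by blast
  obtain g where g: "isometry g" "\<forall>i<l. g (e0 i) = e i \<and> g (f0 i) = f i"
    using hyp_frame_isometry[OF hyp_frame_mono[OF fr assms(2)] assms(1)] by blast
  then show ?thesis
    using isometry_hyp_frame[OF g(1) fr] by (intro exI[of _ "g \<circ> e0"] exI[of _ "g \<circ> f0"]) simp
qed

lemma hyp_frame_1: "hyp_pair a b \<Longrightarrow> hyp_frame 1 (\<lambda>_. a) (\<lambda>_. b)"
  unfolding hyp_frame_def using hyp_pair_simps by auto

lemma singular_hyp_pair:
  assumes "a \<noteq> 0" "q a = 0"
  shows "\<exists>b. hyp_pair a b"
proof -
  have set: "(\<lambda>_. a) ` {..<1::nat} = {a}"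
    by auto
  have "partial_frame 1 0 (\<lambda>_. a) (\<lambda>_. a)"
    unfolding partial_frame_def set using assms q_isotropic[OF assms(2)]
    by (auto simp: inj_on_def vec.dependent_single)
  then obtain f' where "hyp_frame 1 (\<lambda>_. a) f'"
    using partial_frame_extend by blast
  then show ?thesis
    unfolding hyp_frame_def hyp_pair_def by auto
qed

text \<open>The case \<open>l = 0\<close> serves geodesics with one edge. The case
  \<open>l = 1\<close> serves those with two edges, where the third vertex supplies the partner of
  \<open>a\<close>.\<close>

lemma collinear_partial_frame:
  assumes "a \<noteq> 0" "q a = 0" "z \<noteq> 0" "q z = 0" "vec.span {a} \<noteq> vec.span {z}" "B a z = 0"
    and "l = (0::nat) \<or> l = 1 \<and> hyp_pair a b \<and> B z b = 0"
  shows "\<exists>e f. hyp_frame 2 e f \<and> e 0 = a \<and> e 1 = z \<and> (0 < l \<longrightarrow> f 0 = b)"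
proof -
  define e where "e i = (if i = 0 then a else z)" for i :: nat
  have set: "e ` {..<2} = {a, z}"
    by (auto simp: e_def lessThan_Suc numeral_2_eq_2)
  have "a \<notin> vec.span {z}"
  proof
    assume "a \<in> vec.span {z}"
    then have "vec.span {a} = vec.span {z}"
      using point_vertex[OF assms(1,2)] point_vertex[OF assms(3,4)] vec.span_minimal[of "{a}" "vec.span {z}"]
      by (intro vec.subspace_dim_equal) (auto dest: pg_verticesD)
    then show False
      using assms(5) by blast
  qed
  then have "vec.independent {a, z}"
    using assms(3) by (intro vec.independent_insertI) (simp_all add: vec.independent_empty)
  moreover have "a \<noteq> z"
    using assms(5) by blast
  moreover have "B z a = 0"
    using assms(6) orth_sym[of a z] by blast
  ultimately have "partial_frame 2 l e (\<lambda>_. b)"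
    using assms q_isotropic[of a] q_isotropic[of z] hyp_pair_simps[of a b]
    unfolding partial_frame_def set by (auto simp: e_def inj_on_def less_2_cases_iff)
  then obtain f where "hyp_frame 2 e f" "\<forall>i<l. f i = b"
    using partial_frame_extend[of 2 l e "\<lambda>_. b"] assms(7) by fastforce
  then show ?thesis
    by (intro exI[of _ e] exI[of _ f]) (simp add: e_def)
qed

text \<open>Extend \<open>(a, b)\<close> to a full frame and take its next vector
  \<open>e 1\<close>; this is where \<open>1 < \<omega>\<close> enters.\<close>

lemma polar_graph_common_neighbour:
  assumes "1 < \<omega>" "hyp_pair a b"
  shows "\<exists>z. z \<noteq> 0 \<and> q z = 0 \<and> B a z = 0 \<and> B z b = 0"
proof -
  obtain e f where fr: "hyp_frame \<omega> e f" "e 0 = a" "f 0 = b"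
    using hyp_frame_extend[OF hyp_frame_1[OF assms(2)]] assms(1) by auto
  have "B (e 1) (f 1) = 1"
    using hyp_frameD(5)[OF fr(1) assms(1,1)] by simp
  then have "e 1 \<noteq> 0" by auto
  then show ?thesis
    using hyp_frameD[OF fr(1), of 0] hyp_frameD[OF fr(1), of 1] fr(2,3) assms(1)
    by (intro exI[of _ "e 1"]) auto
qed

text \<open>Non-collinear points have generators that form a hyperbolic pair after scaling, and such
  a pair has a common neighbour. So the diameter is at most 2.\<close>

lemma polar_graph_dist:
  assumes \<omega>: "1 < \<omega>" and U: "U \<in> pg_vertices K B Q 1" and W: "W \<in> pg_vertices K B Q 1"
    and "U \<noteq> W" "\<not> pg_adj K B Q 1 U W"
  shows "graph_dist_is (pg_vertices K B Q 1) (pg_adj K B Q 1) U W 2"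
proof -
  obtain a b where a: "a \<noteq> 0" "q a = 0" "U = vec.span {a}" and b: "b \<noteq> 0" "q b = 0" "W = vec.span {b}"
    using point_generator[OF U] point_generator[OF W] by blast
  have "B a b \<noteq> 0"
    using assms(4,5) point_adj[OF \<omega> a(1,2) b(1,2)] a(3) b(3) by blast
  then have hyp: "hyp_pair a (\<sigma> (inverse (B a b)) *s b)"
    using hyp_pair_scale a b by blast
  obtain z where z: "z \<noteq> 0" "q z = 0" "B a z = 0" "B z (\<sigma> (inverse (B a b)) *s b) = 0"
    using polar_graph_common_neighbour[OF \<omega> hyp] by blast
  have zb: "B z b = 0"
    using z(4) \<open>B a b \<noteq> 0\<close> by (simp add: scale_right)
  have "vec.span {a} \<noteq> vec.span {z}"
  proof
    assume "vec.span {a} = vec.span {z}"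
    then have "a \<in> vec.span {z}"
      using vec.span_base[of a "{a}"] by simp
    then show False
      using span_orth[of "{z}" b a] zb \<open>B a b \<noteq> 0\<close> by simp
  qed
  moreover have "vec.span {z} \<noteq> vec.span {b}"
  proof
    assume "vec.span {z} = vec.span {b}"
    then have "b \<in> vec.span {z}"
      using vec.span_base[of b "{b}"] by simp
    then show False
      using span_orth[of "{z}" a b] z(3) \<open>B a b \<noteq> 0\<close> orth_sym[of z a] orth_sym[of a b] by simp
  qed
  ultimately show ?thesis
    using graph_dist_is_2[where E = "pg_adj K B Q 1", OF U W point_vertex[OF z(1,2)] assms(4,5)]
      point_adj[OF \<omega> a(1,2) z(1,2)] point_adj[OF \<omega> z(1,2) b(1,2)] z(3) zb a(3) b(3) by blast
qed

lemma polar_graph_connected: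
  assumes "1 < \<omega>"
  shows "graph_connected (pg_vertices K B Q 1) (pg_adj K B Q 1)"
proof -
  obtain e f where fr: "hyp_frame \<omega> e f"
    using hyp_frame_exists by blast
  have "frame_span e f {0} {} \<in> pg_vertices K B Q 1"
    using assms by (intro frame_span_vertex[OF fr]) auto
  then have "pg_vertices K B Q 1 \<noteq> {}" by blast
  moreover have "\<exists>n. graph_dist_is (pg_vertices K B Q 1) (pg_adj K B Q 1) U W n"
    if "U \<in> pg_vertices K B Q 1" "W \<in> pg_vertices K B Q 1" for U W
    using polar_graph_dist[OF assms that] graph_dist_is_0[OF that(1)] graph_dist_is_1[OF that] by blast
  ultimately show ?thesis
    unfolding graph_connected_def graph_dist_is_def by blast
qed

lemma polar_graph_geodesic_transitive:
  assumes \<omega>: "1 < \<omega>"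
  shows "geodesic_transitive (pg_vertices K B Q 1) (pg_adj K B Q 1)"
\<comment> \<open>The recipe: vertices 0, 1 and 2 are spanned by \<open>e 0\<close>,
  \<open>e 1\<close> and \<open>f 0\<close>.\<close>
proof (rule geodesic_transitiveI[where m = 2 and I = "\<lambda>j. if j < 2 then {j} else {}"
      and J = "\<lambda>j. if j < 2 then {} else {0}"])
  let ?V = "pg_vertices K B Q 1" and ?E = "pg_adj K B Q 1"
  fix xs assume geo: "is_geodesic ?V ?E xs"
  then have walk: "is_walk ?V ?E xs"
    unfolding is_geodesic_def by blast
  then have ends: "hd xs \<in> ?V" "last xs \<in> ?V"
    using is_walk_ends by blast+
  have "\<exists>e f. hyp_frame 2 e f \<and> (\<forall>j<length xs. j \<le> 2 \<and>
      xs ! j = frame_span e f (if j < 2 then {j} else {}) (if j < 2 then {} else {0}))"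
  proof (cases "hd xs = last xs")
    case True
    then have "length xs = Suc 0"
      using geodesic_length[OF geo] graph_dist_is_0[OF ends(1), of ?E] by simp
    then obtain U where xs: "xs = [U]"
      by (auto simp: length_Suc_conv)
    then obtain a where a: "a \<noteq> 0" "q a = 0" "U = vec.span {a}"
      using ends point_generator[of U] by auto
    then obtain b where "hyp_pair a b"
      using singular_hyp_pair by blast
    then obtain e f where fr: "hyp_frame \<omega> e f" "e 0 = a"
      using hyp_frame_extend[OF hyp_frame_1[of a b]] \<omega> by auto
    then show ?thesis
      using hyp_frame_mono[OF fr(1), of 2] \<omega> a xs by (intro exI[of _ e] exI[of _ f]) simp
  next
    case ne: False
    show ?thesis
    proof (cases "?E (hd xs) (last xs)")
      case True
      then have "length xs = 2"
        using geodesic_length[OF geo] graph_dist_is_1[OF ends, of ?E] ne by simp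
      then obtain U Z where xs: "xs = [U, Z]"
        by (auto simp: numeral_2_eq_2 length_Suc_conv)
      obtain a z where a: "a \<noteq> 0" "q a = 0" "U = vec.span {a}" and z: "z \<noteq> 0" "q z = 0" "Z = vec.span {z}"
        using ends point_generator[of U] point_generator[of Z] unfolding xs by auto
      have "vec.span {a} \<noteq> vec.span {z}" "B a z = 0"
        using True point_adj[OF \<omega> a(1,2) z(1,2)] unfolding xs a z by auto
      then obtain e f where "hyp_frame 2 e f" "e 0 = a" "e 1 = z"
        using collinear_partial_frame[OF a(1,2) z(1,2), of 0] by auto
      then show ?thesis
        using xs a z by (intro exI[of _ e] exI[of _ f]) (auto simp: less_Suc_eq)
    next
      case False
      then have "length xs = 3"
        using geodesic_length[OF geo polar_graph_dist[OF \<omega> ends ne False]] by simp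
      then obtain U Z W where xs: "xs = [U, Z, W]"
        by (auto simp: numeral_3_eq_3 length_Suc_conv)
      obtain a z b where a: "a \<noteq> 0" "q a = 0" "U = vec.span {a}" and z: "z \<noteq> 0" "q z = 0" "Z = vec.span {z}"
        and b: "b \<noteq> 0" "q b = 0" "W = vec.span {b}"
        using walk point_generator[of U] point_generator[of Z] point_generator[of W]
        unfolding xs by (auto simp: is_walk_Cons is_walk_singleton)
      have az: "vec.span {a} \<noteq> vec.span {z}" "B a z = 0" and zb: "B z b = 0" and ab: "B a b \<noteq> 0"
        using walk False ne point_adj[OF \<omega> a(1,2) z(1,2)] point_adj[OF \<omega> z(1,2) b(1,2)]
          point_adj[OF \<omega> a(1,2) b(1,2)]
        unfolding xs by (auto simp: is_walk_Cons a b z)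
      \<comment> \<open>Rescales \<open>b\<close> to a partner of \<open>a\<close> without changing
        the point it spans.\<close>
      let ?c = "\<sigma> (inverse (B a b))"
      have "hyp_pair a (?c *s b)" "B z (?c *s b) = 0"
        using hyp_pair_scale[OF a(2) b(2) ab] by (simp_all add: scale_right zb)
      then obtain e f where fr: "hyp_frame 2 e f" "e 0 = a" "e 1 = z" "f 0 = ?c *s b"
        using collinear_partial_frame[OF a(1,2) z(1,2) az, of 1 "?c *s b"] by auto
      have "vec.span {?c *s b} = vec.span {b}"
      proof (rule vec.span_eq[THEN iffD2], intro conjI)
        show "{?c *s b} \<subseteq> vec.span {b}"
          by (simp add: vec.span_scale vec.span_base)
        have "b = inverse ?c *s (?c *s b)"
          using ab by (simp add: vec.scale_scale)
        then show "{b} \<subseteq> vec.span {?c *s b}"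
          using vec.span_scale[OF vec.span_base, of "?c *s b" "{?c *s b}" "inverse ?c"] by simp
      qed
      then have "xs ! 0 = vec.span {e 0}" "xs ! 1 = vec.span {e 1}" "xs ! 2 = vec.span {f 0}"
        using fr(3) by (simp_all add: xs a(3) z(3) b(3) fr(2,4))
      moreover have "j = 0 \<or> j = 1 \<or> j = 2" if "j < length xs" for j
        using that unfolding xs by (auto simp: less_Suc_eq)
      ultimately show ?thesis
        using fr(1) by (intro exI[of _ e] exI[of _ f]) fastforce
    qed
  qed
  then show "\<exists>e f. hyp_frame 2 e f \<and> (\<forall>j<length xs. (if j < 2 then {j} else {}) \<union> (if j < 2 then {} else {0}) \<subseteq> {..<2} \<and>
      xs ! j = frame_span e f (if j < 2 then {j} else {}) (if j < 2 then {} else {0}))"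
    by (elim exE, intro exI) auto
qed


subsection \<open>The dual polar graph\<close>

abbreviation dual_vertices :: "('a ^ 'n) set set" where
  "dual_vertices \<equiv> pg_vertices K B Q \<omega>"

abbreviation dual_adj :: "('a ^ 'n) set \<Rightarrow> ('a ^ 'n) set \<Rightarrow> bool" where
  "dual_adj \<equiv> pg_adj K B Q \<omega>"

text \<open>Otherwise \<open>w\<close> and \<open>U\<close> would span a singular subspace of
  dimension \<open>\<omega> + 1\<close>.\<close>

lemma maximal_contains_orth:
  assumes U: "U \<in> dual_vertices" and "q w = 0" "\<And>u. u \<in> U \<Longrightarrow> B u w = 0"
  shows "w \<in> U"
proof (rule ccontr)
  assume w: "w \<notin> U"
  note UD = pg_verticesD[OF U]
  have "B w u = 0" if "u \<in> U" for u
    using assms(3)[OF that] orth_sym[of w u] by blast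
  then have "singular K B Q (vec.span (insert w U))"
    using assms(2,3) UD(4,5) q_isotropic[OF assms(2)] by (intro singular_span) blast+
  then have "vec.dim (insert w U) \<le> \<omega>"
    using singular_dim_le by force
  moreover have "vec.dim (insert w U) = Suc \<omega>"
    using w UD(3) by (simp add: vec.dim_insert vec.span_eq_iff[THEN iffD2, OF UD(2)])
  ultimately show False by simp
qed

section \<open>Distance in the dual polar graph as codimension of the intersection\<close>

lemma dim_orth_hyperplane:
  assumes "vec.subspace U"
  shows "vec.subspace (U \<inter> {u. B u w = 0})" "vec.dim U \<le> Suc (vec.dim (U \<inter> {u. B u w = 0}))"
proof -
  let ?H = "U \<inter> {u. B u w = 0}"
  show "vec.subspace ?H"
    using assms by (auto simp: vec.subspace_def form_simps)
  show "vec.dim U \<le> Suc (vec.dim ?H)"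
  proof (cases "?H = U")
    case False
    then obtain a where a: "a \<in> U" "B a w \<noteq> 0" by blast
    have "U \<subseteq> vec.span (insert a ?H)"
    proof
      fix u assume u: "u \<in> U"
      define c where "c = B u w / B a w"
      have "u - c *s a \<in> ?H"
        using a u assms by (simp add: vec.subspace_diff vec.subspace_scale form_simps c_def)
      then show "u \<in> vec.span (insert a ?H)"
        unfolding vec.span_breakdown_eq by (intro exI[of _ c]) (rule vec.span_base)
    qed
    then have "vec.dim U \<le> vec.dim (insert a ?H)"
      by (rule vec.dim_mono)
    also have "\<dots> \<le> Suc (vec.dim ?H)"
      by (simp add: vec.dim_insert)
    finally show ?thesis .
  qed simp
qed

text \<open>The dimension formula inside \<open>W\<close>. Keeping the triple intersection makes the
  case of equality informative.\<close>

lemma dim_Int_triangle: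
  assumes "U \<in> pg_vertices K B Q k" "W \<in> pg_vertices K B Q k" "X \<in> pg_vertices K B Q k"
  shows "vec.dim (U \<inter> W) + vec.dim (W \<inter> X) \<le> k + vec.dim ((U \<inter> W) \<inter> (W \<inter> X))"
proof -
  note sub = pg_verticesD(2)[OF assms(1)] pg_verticesD(2)[OF assms(2)] pg_verticesD(2)[OF assms(3)]
  have "subspace_sum (U \<inter> W) (W \<inter> X) \<subseteq> W"
    using sub(2) by (auto simp: subspace_sum_def vec.subspace_add)
  then have "vec.dim (subspace_sum (U \<inter> W) (W \<inter> X)) \<le> k"
    using vec.dim_subset pg_verticesD(3)[OF assms(2)] by blast
  then show ?thesis
    using dim_subspace_sum[of "U \<inter> W" "W \<inter> X"] sub by (simp add: vec.subspace_inter)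
qed

lemma dim_Int_triangle':
  assumes "U \<in> pg_vertices K B Q k" "W \<in> pg_vertices K B Q k" "X \<in> pg_vertices K B Q k"
  shows "vec.dim (U \<inter> W) + vec.dim (W \<inter> X) \<le> k + vec.dim (U \<inter> X)"
  using dim_Int_triangle[OF assms] vec.dim_subset[of "(U \<inter> W) \<inter> (W \<inter> X)" "U \<inter> X"] by fastforce

lemma dual_walk_dim:
  assumes walk: "is_walk dual_vertices dual_adj xs" and "i \<le> j" "j < length xs"
  shows "\<omega> \<le> vec.dim (xs ! i \<inter> xs ! j) + (j - i)"
  using assms(2,3)
proof (induction j rule: dec_induct)
  case base
  then have "xs ! i \<in> dual_vertices"
    using walk nth_mem unfolding is_walk_def by blast
  then show ?case
    by (simp add: pg_verticesD(3))
next
  case (step j)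
  have V: "xs ! t \<in> dual_vertices" if "t < length xs" for t
    using walk that nth_mem unfolding is_walk_def by blast
  have "vec.dim (xs ! j \<inter> xs ! Suc j) = \<omega> - 1"
    using walk step.prems unfolding is_walk_def pg_adj_def by simp
  moreover have "vec.dim (xs ! i \<inter> xs ! j) + vec.dim (xs ! j \<inter> xs ! Suc j) \<le> \<omega> + vec.dim (xs ! i \<inter> xs ! Suc j)"
    using step.prems step.hyps by (intro dim_Int_triangle' V) auto
  moreover have "\<omega> \<le> vec.dim (xs ! i \<inter> xs ! j) + (j - i)"
    using step.IH step.prems by simp
  ultimately show ?case
    using step.hyps by linarith
qed

text \<open>Take \<open>w\<close> in \<open>W\<close> outside \<open>U\<close> and replace
  \<open>U\<close> by the span of \<open>w\<close> and the hyperplane of \<open>U\<close> orthogonal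
  to \<open>w\<close>. This hyperplane contains \<open>U \<inter> W\<close>, as \<open>W\<close> is
  singular, so the intersection with \<open>W\<close> gains \<open>w\<close>.\<close>

lemma dual_step:
  assumes U: "U \<in> dual_vertices" and W: "W \<in> dual_vertices" and "U \<noteq> W"
  shows "\<exists>U'\<in>dual_vertices. dual_adj U U' \<and> vec.dim (U \<inter> W) < vec.dim (U' \<inter> W)"
proof -
  note UD = pg_verticesD[OF U] and WD = pg_verticesD[OF W]
  have "\<not> W \<subseteq> U"
    using vec.subspace_dim_equal[OF WD(2) UD(2)] UD(3) WD(3) assms(3) by auto
  then obtain w where w: "w \<in> W" "w \<notin> U" by blast
  define H where "H = U \<inter> {u. B u w = 0}"
  have H: "vec.subspace H" "\<omega> \<le> Suc (vec.dim H)" "H \<subseteq> U"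
    using dim_orth_hyperplane[OF UD(2), of w] UD(3) unfolding H_def by auto
  define U' where "U' = vec.span (insert w H)"
  have "B w u = 0" if "u \<in> H" for u
    using that orth_sym[of w u] unfolding H_def by blast
  then have sing: "singular K B Q U'"
    unfolding U'_def using WD(4)[OF w(1)] WD(5)[OF w(1) w(1)] UD(4,5)
    by (intro singular_span) (auto simp: H_def)
  have "w \<notin> vec.span H"
    using w(2) H(3) vec.span_eq_iff[THEN iffD2, OF H(1)] by blast
  then have "vec.dim U' = Suc (vec.dim H)"
    unfolding U'_def by (simp add: vec.dim_insert)
  moreover have "vec.dim U' \<le> \<omega>"
    using sing by (rule singular_dim_le)
  ultimately have dim: "vec.dim U' = \<omega>" "Suc (vec.dim H) = \<omega>"
    using H(2) by auto
  have V': "U' \<in> dual_vertices"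
    using sing dim unfolding pg_vertices_def by simp
  have w': "w \<in> U'" and HU': "H \<subseteq> U'"
    unfolding U'_def by (auto intro: vec.span_base)
  have sub: "vec.subspace U'"
    using sing singularD(1) by blast
  have "vec.dim H \<le> vec.dim (U \<inter> U')"
    using H(3) HU' by (intro vec.dim_subset) auto
  moreover have "vec.dim (U \<inter> U') < \<omega>"
  proof (rule ccontr)
    assume "\<not> vec.dim (U \<inter> U') < \<omega>"
    then have "U \<inter> U' = U'"
      using dim(1) UD(2) sub by (intro vec.subspace_dim_equal) (auto intro: vec.subspace_inter)
    then show False
      using w(2) w' by blast
  qed
  ultimately have adj: "dual_adj U U'"
    unfolding pg_adj_def using dim(2) by simp
  have "w \<notin> vec.span (U \<inter> W)"
    using w(2) vec.span_eq_iff[THEN iffD2, OF vec.subspace_inter[OF UD(2) WD(2)]] by blast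
  then have "vec.dim (insert w (U \<inter> W)) = Suc (vec.dim (U \<inter> W))"
    by (simp add: vec.dim_insert)
  moreover have "insert w (U \<inter> W) \<subseteq> U' \<inter> W"
    using w w' HU' WD(5) unfolding H_def by auto
  ultimately have "vec.dim (U \<inter> W) < vec.dim (U' \<inter> W)"
    using vec.dim_subset[of "insert w (U \<inter> W)" "U' \<inter> W"] by linarith
  then show ?thesis
    using V' adj by blast
qed

text \<open>Each step gains at least one dimension of intersection with \<open>W\<close>.
  \<open>length\<close> counts vertices, hence the \<open>Suc\<close>.\<close>

lemma dual_walk_exists:
  assumes "U \<in> dual_vertices" "W \<in> dual_vertices"
  shows "\<exists>xs. is_walk dual_vertices dual_adj xs \<and> hd xs = U \<and> last xs = W \<and>
    length xs \<le> Suc (\<omega> - vec.dim (U \<inter> W))"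
  using assms(1)
proof (induction "\<omega> - vec.dim (U \<inter> W)" arbitrary: U rule: less_induct)
  case less
  show ?case
  proof (cases "U = W")
    case True
    then show ?thesis
      using less.prems by (intro exI[of _ "[U]"]) (simp add: is_walk_singleton)
  next
    case False
    then obtain U' where U': "U' \<in> dual_vertices" "dual_adj U U'" "vec.dim (U \<inter> W) < vec.dim (U' \<inter> W)"
      using dual_step[OF less.prems assms(2)] by blast
    have "vec.dim (U' \<inter> W) \<le> \<omega>"
      using vec.dim_subset[of "U' \<inter> W" W] pg_verticesD(3)[OF assms(2)] by simp
    then have lt: "\<omega> - vec.dim (U' \<inter> W) < \<omega> - vec.dim (U \<inter> W)"
      using U'(3) by linarith
    then obtain xs where xs: "is_walk dual_vertices dual_adj xs" "hd xs = U'" "last xs = W"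
      "length xs \<le> Suc (\<omega> - vec.dim (U' \<inter> W))"
      using less.hyps[OF lt U'(1)] by blast
    then obtain ys where ys: "xs = U' # ys"
      by (cases xs) (auto simp: is_walk_def)
    have "is_walk dual_vertices dual_adj (U # xs)"
      using xs(1) less.prems U'(2) unfolding ys by (simp add: is_walk_Cons)
    moreover have "last (U # xs) = W"
      using xs(3) ys by simp
    moreover have "length (U # xs) \<le> Suc (\<omega> - vec.dim (U \<inter> W))"
      using xs(4) lt by simp
    ultimately show ?thesis
      by (intro exI[of _ "U # xs"]) simp
  qed
qed

lemma dual_polar_graph_connected: "graph_connected dual_vertices dual_adj"
proof -
  have "dual_vertices \<noteq> {}"
    using max_singular_exists unfolding pg_vertices_def by blast
  then show ?thesis
    unfolding graph_connected_def using dual_walk_exists by blast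
qed

text \<open>Codimension obeys the triangle inequality and is at most the number of steps along each
  segment. A geodesic attains the bound between its ends, so no segment has slack.\<close>

lemma dual_geodesic_dim:
  assumes geo: "is_geodesic dual_vertices dual_adj xs" and ij: "i \<le> j" "j < length xs"
  shows "vec.dim (xs ! i \<inter> xs ! j) + (j - i) = \<omega>"
proof -
  have walk: "is_walk dual_vertices dual_adj xs"
    and dist: "graph_dist_is dual_vertices dual_adj (hd xs) (last xs) (length xs - 1)"
    using geo unfolding is_geodesic_def by auto
  have ne: "xs \<noteq> []"
    using ij by auto
  define l where "l = length xs - 1"
  have l: "length xs = Suc l"
    using ne unfolding l_def by (cases xs) auto
  have V: "xs ! t \<in> dual_vertices" if "t < length xs" for t
    using walk that nth_mem unfolding is_walk_def by blast
  have ends: "hd xs = xs ! 0" "last xs = xs ! l"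
    using ne by (simp_all add: hd_conv_nth last_conv_nth l_def)
  obtain ys where "is_walk dual_vertices dual_adj ys" "hd ys = hd xs" "last ys = last xs"
    "length ys \<le> Suc (\<omega> - vec.dim (hd xs \<inter> last xs))"
    using dual_walk_exists[of "hd xs" "last xs"] is_walk_ends[OF walk] by blast
  then have "Suc l \<le> Suc (\<omega> - vec.dim (xs ! 0 \<inter> xs ! l))"
    using dist unfolding graph_dist_is_def l_def[symmetric] ends by (meson le_trans)
  moreover have "vec.dim (xs ! 0 \<inter> xs ! l) \<le> \<omega>"
    using vec.dim_subset[of "xs ! 0 \<inter> xs ! l" "xs ! 0"] pg_verticesD(3)[OF V[of 0]] l by simp
  ultimately have "l + vec.dim (xs ! 0 \<inter> xs ! l) \<le> \<omega>"
    by linarith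
  moreover have "vec.dim (xs ! 0 \<inter> xs ! i) + vec.dim (xs ! i \<inter> xs ! j) \<le> \<omega> + vec.dim (xs ! 0 \<inter> xs ! j)"
    using ij by (intro dim_Int_triangle' V) auto
  moreover have "vec.dim (xs ! 0 \<inter> xs ! j) + vec.dim (xs ! j \<inter> xs ! l) \<le> \<omega> + vec.dim (xs ! 0 \<inter> xs ! l)"
    using ij l by (intro dim_Int_triangle' V) auto
  moreover have "\<omega> \<le> vec.dim (xs ! 0 \<inter> xs ! i) + (i - 0)"
    using ij by (intro dual_walk_dim[OF walk]) auto
  moreover have "\<omega> \<le> vec.dim (xs ! j \<inter> xs ! l) + (l - j)"
    using ij l by (intro dual_walk_dim[OF walk]) auto
  moreover have "\<omega> \<le> vec.dim (xs ! i \<inter> xs ! j) + (j - i)"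
    using ij by (intro dual_walk_dim[OF walk]) auto
  moreover have "j \<le> l"
    using ij l by simp
  ultimately show ?thesis
    using ij(1) by linarith
qed

text \<open>The codimensions add up along a geodesic, so the triple intersection is as large as
  \<open>xs ! i \<inter> xs ! t\<close>.\<close>

lemma dual_geodesic_Int_subset:
  assumes geo: "is_geodesic dual_vertices dual_adj xs" and ij: "i \<le> j" "j \<le> t" "t < length xs"
  shows "xs ! i \<inter> xs ! t \<subseteq> xs ! j"
proof -
  have V: "xs ! s \<in> dual_vertices" if "s < length xs" for s
    using geo that nth_mem unfolding is_geodesic_def is_walk_def by blast
  have sub: "vec.subspace (xs ! s)" if "s < length xs" for s
    using pg_verticesD(2)[OF V[OF that]] .
  let ?I = "(xs ! i \<inter> xs ! j) \<inter> (xs ! j \<inter> xs ! t)"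
  have "vec.dim (xs ! i \<inter> xs ! j) + vec.dim (xs ! j \<inter> xs ! t) \<le> \<omega> + vec.dim ?I"
    using ij by (intro dim_Int_triangle V) auto
  moreover have "vec.dim (xs ! i \<inter> xs ! j) + (j - i) = \<omega>"
    using ij by (intro dual_geodesic_dim[OF geo]) auto
  moreover have "vec.dim (xs ! j \<inter> xs ! t) + (t - j) = \<omega>"
    using ij by (intro dual_geodesic_dim[OF geo]) auto
  moreover have "vec.dim (xs ! i \<inter> xs ! t) + (t - i) = \<omega>"
    using ij by (intro dual_geodesic_dim[OF geo]) auto
  ultimately have "vec.dim (xs ! i \<inter> xs ! t) \<le> vec.dim ?I"
    using ij(1,2) by linarith
  then have "?I = xs ! i \<inter> xs ! t"
    using ij sub by (intro vec.subspace_dim_equal) (auto intro!: vec.subspace_inter)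
  then show ?thesis by blast
qed

text \<open>For a geodesic \<open>v\<^sub>0, \<dots>, v\<^sub>l\<close> the spaces \<open>v\<^sub>0 \<inter> v\<^sub>j\<close> decrease and the spaces \<open>v\<^sub>j \<inter> v\<^sub>l\<close> increase
  with \<open>j\<close>. A basis adapted to the first chain is completed, by Gram-Schmidt along the second one,
  to a frame in which \<open>v\<^sub>j\<close> is spanned by the \<open>f\<^sub>i\<close> with \<open>i < j\<close> and the \<open>e\<^sub>i\<close> with \<open>i \<ge> j\<close>.\<close>

lemma dual_geodesic_frame:
  assumes geo: "is_geodesic dual_vertices dual_adj xs"
  shows "\<exists>e f. hyp_frame \<omega> e f \<and> (\<forall>j<length xs. {j..<\<omega>} \<union> {..<j} \<subseteq> {..<\<omega>} \<and>
    xs ! j = frame_span e f {j..<\<omega>} {..<j})"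
proof -
  have walk: "is_walk dual_vertices dual_adj xs"
    using geo unfolding is_geodesic_def by blast
  obtain l where l: "length xs = Suc l"
    using walk by (cases xs) (auto simp: is_walk_def)
  define v where "v j = xs ! j" for j
  have V: "v j \<in> dual_vertices" if "j \<le> l" for j
    using walk that nth_mem[of j xs] l unfolding is_walk_def v_def by auto
  note sub = pg_verticesD(2)[OF V]
  have dim: "vec.dim (v i \<inter> v j) + (j - i) = \<omega>" if "i \<le> j" "j \<le> l" for i j
    unfolding v_def using that l by (intro dual_geodesic_dim[OF geo]) auto
  have nested: "v i \<inter> v t \<subseteq> v j" if "i \<le> j" "j \<le> t" "t \<le> l" for i j t
    unfolding v_def using that l by (intro dual_geodesic_Int_subset[OF geo]) auto
  have l\<omega>: "l \<le> \<omega>"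
    using dim[of 0 l] by simp
  have "\<exists>e. inj_on e {..<\<omega>} \<and> vec.independent (e ` {..<\<omega>}) \<and> (\<forall>t\<le>l. e ` {t..<\<omega>} \<subseteq> v 0 \<inter> v t)"
  proof (rule decreasing_chain_basis)
    show "vec.subspace (v 0 \<inter> v j)" if "j \<le> l" for j
      using sub that by (simp add: vec.subspace_inter)
    show "vec.dim (v 0 \<inter> v j) = \<omega> - j" if "j \<le> l" for j
      using dim[of 0 j] that by simp
    show "v 0 \<inter> v (Suc j) \<subseteq> v 0 \<inter> v j" if "j < l" for j
      using nested[of 0 j "Suc j"] that by auto
  qed (rule l\<omega>)
  then obtain e where inj: "inj_on e {..<\<omega>}" and ind: "vec.independent (e ` {..<\<omega>})"
    and mem: "\<And>t. t \<le> l \<Longrightarrow> e ` {t..<\<omega>} \<subseteq> v 0 \<inter> v t"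
    by blast
  have e0: "e i \<in> v 0" if "i < \<omega>" for i
    using mem[of 0] that by auto
  have et: "e i \<in> v t" if "t \<le> i" "i < \<omega>" "t \<le> l" for i t
    using mem[of t] that by auto
  have "\<exists>f. \<forall>i<j. f i \<in> v (Suc i) \<inter> v l \<and> (\<forall>a<\<omega>. B (e a) (f i) = (if a = i then 1 else 0))"
    if "j \<le> l" for j
    using that
  proof (induction j)
    case 0
    then show ?case by simp
  next
    case (Suc j)
    then obtain f where f: "\<And>i. i < j \<Longrightarrow> f i \<in> v (Suc i) \<inter> v l"
      "\<And>i a. i < j \<Longrightarrow> a < \<omega> \<Longrightarrow> B (e a) (f i) = (if a = i then 1 else 0)"
      by auto
    have j: "j < l" "j < \<omega>"
      using Suc.prems l\<omega> by auto
    have fj: "f i \<in> v j \<inter> v l" if "i < j" for i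
      using f(1)[OF that] nested[of "Suc i" j l] that j by auto
    have "vec.dim (v j \<inter> v l) < vec.dim (v (Suc j) \<inter> v l)"
      using dim[of j l] dim[of "Suc j" l] j by auto
    then have "\<not> v (Suc j) \<inter> v l \<subseteq> v j \<inter> v l"
      using vec.dim_subset[of "v (Suc j) \<inter> v l" "v j \<inter> v l"] by auto
    then obtain x where x: "x \<in> v (Suc j) \<inter> v l" "x \<notin> v j \<inter> v l"
      by blast
    \<comment> \<open>\<open>y\<close> has the same products with \<open>e i\<close> as
      \<open>x\<close> for \<open>i < j\<close>; the \<open>\<sigma>\<close> undoes the
      semilinearity.\<close>
    define y where "y = (\<Sum>i<j. \<sigma> (B (e i) x) *s f i)"
    have subj: "vec.subspace (v j \<inter> v l)" "vec.subspace (v (Suc j) \<inter> v l)"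
      using sub j by (auto intro!: vec.subspace_inter)
    have y: "y \<in> v j \<inter> v l"
      unfolding y_def using fj
      by (intro vec.subspace_sum[OF subj(1)] vec.subspace_scale[OF subj(1)]) simp
    then have y': "y \<in> v (Suc j) \<inter> v l"
      using nested[of j "Suc j" l] j by auto
    define g where "g = x - y"
    have g: "g \<in> v (Suc j) \<inter> v l" "g \<notin> v j \<inter> v l"
    proof -
      show "g \<in> v (Suc j) \<inter> v l"
        unfolding g_def using x(1) y' subj(2) by (intro vec.subspace_diff)
      show "g \<notin> v j \<inter> v l"
        using vec.subspace_add[OF subj(1) _ y, of g] x(2) unfolding g_def by auto
    qed
    have qg: "q g = 0"
      using g(1) pg_verticesD(4)[OF V[of l]] by auto
    have ey: "B (e a) y = (if a < j then B (e a) x else 0)" if "a < \<omega>" for a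
    proof -
      have "B y (e a) = (\<Sum>i<j. if i = a then \<sigma> (B (e a) x) * \<epsilon> else 0)"
        unfolding y_def sum_left
      proof (rule sum.cong)
        fix i assume "i \<in> {..<j}"
        then have "B (f i) (e a) = (if i = a then \<epsilon> else 0)"
          using f(2)[of i a] that swap[of "f i" "e a"] by simp
        then show "B (\<sigma> (B (e i) x) *s f i) (e a) = (if i = a then \<sigma> (B (e a) x) * \<epsilon> else 0)"
          by (simp add: scale_left)
      qed simp
      then have "B y (e a) = (if a < j then \<sigma> (B (e a) x) * \<epsilon> else 0)"
        by simp
      then show ?thesis
        using swap[of "e a" y] by (simp add: \<sigma>_mult \<sigma>_\<sigma> \<sigma>_\<epsilon> \<epsilon>_\<epsilon> mult.commute)
    qed
    have eg0: "B (e a) g = 0" if "a < \<omega>" "a \<noteq> j" for a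
    proof (cases "a < j")
      case True
      then show ?thesis
        using ey[OF that(1)] by (simp add: g_def diff_right)
    next
      case False
      \<comment> \<open>For \<open>a > j\<close> the product vanishes because \<open>e a\<close> and
        \<open>g\<close> lie in the same singular subspace.\<close>
      then have "e a \<in> v (Suc j)"
        using et[of "Suc j" a] that j by simp
      then show ?thesis
        using g(1) pg_verticesD(5)[OF V[of "Suc j"]] j by auto
    qed
    \<comment> \<open>Otherwise \<open>g\<close> is orthogonal to all of \<open>v 0\<close>, so by
      maximality \<open>g\<close> lies in \<open>v 0 \<inter> v l\<close>, which is contained in
      \<open>v j\<close>.\<close>
    have egj: "B (e j) g \<noteq> 0"
    proof
      assume "B (e j) g = 0"
      then have "B (e a) g = 0" if "a < \<omega>" for a
        using eg0 that by (cases "a = j") auto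
      then have "B u g = 0" if "u \<in> vec.span (e ` {..<\<omega>})" for u
        using span_orth[OF _ that] by auto
      moreover have "v 0 \<subseteq> vec.span (e ` {..<\<omega>})"
      proof -
        have "vec.span (e ` {..<\<omega>}) = v 0"
          using e0 sub[of 0] pg_verticesD(3)[OF V[of 0]] vec.dim_span_eq_card_independent[OF ind]
            card_image[OF inj]
          by (intro vec.subspace_dim_equal vec.span_minimal) auto
        then show ?thesis by simp
      qed
      ultimately have "g \<in> v 0"
        using maximal_contains_orth[OF V[of 0] qg] by auto
      then show False
        using g nested[of 0 j l] j by auto
    qed
    define h where "h = \<sigma> (inverse (B (e j) g)) *s g"
    have h: "h \<in> v (Suc j) \<inter> v l"
      unfolding h_def using g(1) subj(2) by (intro vec.subspace_scale)
    have eh: "B (e a) h = (if a = j then 1 else 0)" if "a < \<omega>" for a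
      using that eg0 egj by (simp add: h_def scale_right \<sigma>_\<sigma>)
    show ?case
      using f h eh by (intro exI[of _ "f(j := h)"]) (auto simp: less_Suc_eq)
  qed
  then obtain f where f: "\<And>i. i < l \<Longrightarrow> f i \<in> v (Suc i) \<inter> v l"
    "\<And>i a. i < l \<Longrightarrow> a < \<omega> \<Longrightarrow> B (e a) (f i) = (if a = i then 1 else 0)"
    by blast
  \<comment> \<open>All \<open>f i\<close> lie in the singular subspace \<open>v l\<close>, which
    makes them singular and mutually orthogonal.\<close>
  have "partial_frame \<omega> l e f"
    unfolding partial_frame_def
    using inj ind f e0 pg_verticesD(4,5)[OF V[of 0]] pg_verticesD(4,5)[OF V[of l]] by auto
  then obtain f' where fr: "hyp_frame \<omega> e f'" and f': "\<And>i. i < l \<Longrightarrow> f' i = f i"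
    using partial_frame_extend[OF _ l\<omega>] by blast
  have "frame_span e f' {j..<\<omega>} {..<j} = v j" if "j \<le> l" for j
  proof (rule vec.subspace_dim_equal)
    show "frame_span e f' {j..<\<omega>} {..<j} \<subseteq> v j"
    proof (rule vec.span_minimal)
      have "f' i \<in> v j" if "i < j" for i
        using f(1)[of i] f'[of i] nested[of "Suc i" j l] that \<open>j \<le> l\<close> by auto
      then show "e ` {j..<\<omega>} \<union> f' ` {..<j} \<subseteq> v j"
        using et[of j] that by auto
    qed (rule sub[OF that])
    show "vec.dim (v j) \<le> vec.dim (frame_span e f' {j..<\<omega>} {..<j})"
    proof -
      have "{j..<\<omega>} \<subseteq> {..<\<omega>}" "{..<j} \<subseteq> {..<\<omega>}"
        using that l\<omega> by auto
      from frame_span_dim[OF fr this] show ?thesis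
        using pg_verticesD(3)[OF V[OF that]] that l\<omega> by simp
    qed
  qed (use sub that in auto)
  then show ?thesis
    using fr l l\<omega> unfolding v_def by (intro exI[of _ e] exI[of _ f']) auto
qed

lemma dual_polar_graph_geodesic_transitive: "geodesic_transitive dual_vertices dual_adj"
  by (rule geodesic_transitiveI[OF dual_geodesic_frame])

lemma grassmann_graph_iff:
  assumes "2 \<le> \<omega>" "1 \<le> k" "k \<le> \<omega>"
  shows "(geodesic_transitive (pg_vertices K B Q k) (pg_adj K B Q k)
            \<longleftrightarrow> distance_regular (pg_vertices K B Q k) (pg_adj K B Q k))
       \<and> (distance_regular (pg_vertices K B Q k) (pg_adj K B Q k)
            \<longleftrightarrow> (k = 1 \<or> k = \<omega>))"
proof (cases "k = 1 \<or> k = \<omega>")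
  case True
  then have gt: "geodesic_transitive (pg_vertices K B Q k) (pg_adj K B Q k)"
    and "graph_connected (pg_vertices K B Q k) (pg_adj K B Q k)"
    using polar_graph_geodesic_transitive polar_graph_connected assms(1)
      dual_polar_graph_geodesic_transitive dual_polar_graph_connected by auto
  then show ?thesis
    using True geodesic_transitive_imp_distance_regular by blast
next
  case False
  then show ?thesis
    using not_distance_regular_between[of k] assms by auto
qed

end

section \<open>The classical formed spaces\<close>

text \<open>The form is alternating, so \<open>v \<mapsto> B v v\<close> is zero and its
  polarization needs no trace term; skew symmetry gives \<open>\<epsilon> = - 1\<close>.\<close>

lemma symplectic_polar_space:
  assumes "symplectic_space B"
  shows "polar_space Symplectic B Q (\<lambda>_. 0) id (- 1) (\<lambda>_. 0)"
proof -
  have add: "B (u + v) w = B u w + B v w" "B w (u + v) = B w u + B w v"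
    and scale: "B (c *s u) v = c * B u v" "B u (c *s v) = c * B u v"
    and alt: "B v v = 0" and nondeg: "(\<And>w. B v w = 0) \<Longrightarrow> v = 0" for u v w c
    using assms unfolding symplectic_space_def sesquilinear_def biadditive_def nondegenerate_form_def by auto
  show ?thesis
  proof unfold_locales
    show "B v u = - 1 * id (B u v)" for u v
      using alt[of "u + v"] alt[of u] alt[of v] by (simp add: add eq_neg_iff_add_eq_0 add.commute)
    show "v = 0" if "\<And>w. B v w = 0" for v
      using nondeg that by blast
    show "singular Symplectic B Q U \<longleftrightarrow>
        vec.subspace U \<and> (\<forall>u\<in>U. 0 = 0) \<and> (\<forall>u\<in>U. \<forall>v\<in>U. B u v = 0)" for U
      unfolding singular_def by simp
  qed (simp_all add: add scale alt)
qed

lemma orthogonal_polar_space: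
  assumes "orthogonal_space B Q"
  shows "polar_space Orthogonal B Q Q id 1 id"
proof -
  have add: "B (u + v) w = B u w + B v w" "B w (u + v) = B w u + B w v"
    and scale: "B (c *s u) v = c * B u v" "B u (c *s v) = c * B u v"
    and Q_scale: "Q (c *s v) = c ^ 2 * Q v" and B: "B u v = Q (u + v) - Q u - Q v"
    and nondeg: "Q v = 0 \<Longrightarrow> (\<And>w. B v w = 0) \<Longrightarrow> v = 0" for u v w c
    using assms unfolding orthogonal_space_def sesquilinear_def biadditive_def by auto
  show ?thesis
  proof unfold_locales
    show "B v v = 0" if "Q v = 0" for v
    proof -
      \<comment> \<open>Computes \<open>B v v\<close> as \<open>Q (2 *s v) - Q v - Q v\<close>,
        without dividing by 2.\<close>
      have "v + v = 2 *s v"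
        using vec.scale_left_distrib[of 1 1 v] by simp
      then have "Q (v + v) = 0"
        using that by (simp only: Q_scale mult_zero_right)
      then show ?thesis
        using that B[of v v] by simp
    qed
    show "\<exists>a. Q v + id a = 0" for v
      by (rule exI[of _ "- Q v"]) simp
    show "B v u = 1 * id (B u v)" for u v
      by (simp add: B add.commute)
    show "Q (u + v) = Q u + Q v + id (B u v)" for u v
      by (simp add: B)
    show "v = 0" if "Q v = 0" "\<And>w. B v w = 0" for v
      using nondeg that by blast
    show "singular Orthogonal B Q U \<longleftrightarrow>
        vec.subspace U \<and> (\<forall>u\<in>U. Q u = 0) \<and> (\<forall>u\<in>U. \<forall>v\<in>U. B u v = 0)" for U
      unfolding singular_def by (auto simp: B vec.subspace_add)
    show "Q (c *s v) = 0" if "Q v = 0" for c v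
      using that by (simp add: Q_scale)
  qed (simp_all add: add scale)
qed

text \<open>Evaluating \<open>B\<close> on multiples of a pair with \<open>B u w = 1\<close> shows that \<open>x \<mapsto> x ^ r\<close> is an
  involutory field automorphism. Its trace \<open>x + x ^ r\<close> is not identically zero, since a polynomial
  of degree \<open>r\<close> cannot vanish on all \<open>r\<^sup>2\<close> elements, so it maps onto the fixed field.\<close>

lemma unitary_polar_space:
  fixes B :: "'a::{field,finite} ^ 'n \<Rightarrow> 'a ^ 'n \<Rightarrow> 'a"
  assumes "unitary_space B"
  shows "\<exists>r. polar_space Unitary B Q (\<lambda>v. B v v) (\<lambda>x. x ^ r) 1 (\<lambda>x. x + x ^ r)"
proof -
  obtain r where card: "r * r = CARD('a)" and sesq: "sesquilinear (\<lambda>x. x ^ r) B"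
    and swap: "\<And>u v. B v u = (B u v) ^ r" and nd: "nondegenerate_form B"
    using assms unfolding unitary_space_def by blast
  from sesq nd have add: "B (u + v) w = B u w + B v w" "B w (u + v) = B w u + B w v"
    and scale: "B (c *s u) v = c * B u v" "B u (c *s v) = c ^ r * B u v"
    and nondeg: "(\<And>w. B v w = 0) \<Longrightarrow> v = 0" for u v w c
    unfolding sesquilinear_def biadditive_def nondegenerate_form_def by auto
  have r: "1 < r"
  proof -
    have "card {0, 1 :: 'a} \<le> CARD('a)"
      by (rule card_mono) auto
    then have "2 \<le> r * r"
      unfolding card by simp
    moreover have "r = 0 \<or> r = 1 \<or> 1 < r"
      by linarith
    ultimately show ?thesis by auto
  qed
  have "axis undefined 1 \<noteq> (0 :: 'a ^ 'n)"
    by (simp add: axis_eq_0_iff)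
  then obtain u0 w where "B u0 w \<noteq> 0"
    using nondeg by blast
  define u where "u = inverse (B u0 w) *s u0"
  have uw: "B u w = 1"
    using \<open>B u0 w \<noteq> 0\<close> by (simp add: u_def scale)
  have wu: "B w u = 1"
    using swap[of w u] uw by simp
  have power_power: "(c ^ r) ^ r = c" for c :: 'a
    using swap[of "c *s u" w] by (simp add: scale uw wu)
  have power_add: "(c + d) ^ r = c ^ r + d ^ r" for c d :: 'a
  proof -
    have "(c + d) ^ r = B w ((c + d) *s u)"
      by (simp only: scale wu mult_1_right)
    also have "\<dots> = c ^ r + d ^ r"
      by (simp only: vec.scale_left_distrib add scale wu mult_1_right)
    finally show ?thesis .
  qed
  have zero_power: "(0 :: 'a) ^ r = 0"
    using r by simp
  have neg_one_power: "(- 1 :: 'a) ^ r = - 1"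
    \<comment> \<open>Additivity of the power map settles the sign in every characteristic.\<close>
    using power_add[of 1 "- 1"] zero_power by (simp add: eq_neg_iff_add_eq_0 add.commute)
  have "\<exists>a :: 'a. a + a ^ r \<noteq> 0"
  proof (rule ccontr)
    assume "\<nexists>a :: 'a. a + a ^ r \<noteq> 0"
    define p :: "'a poly" where "p = monom 1 r + monom 1 1"
    have deg: "degree p = r"
      unfolding p_def using r by (subst degree_add_eq_left) (simp_all add: degree_monom_eq)
    then have "p \<noteq> 0"
      using r by auto
    then have "card {x. poly p x = 0} \<le> r"
      using card_poly_roots_bound deg by blast
    moreover have "{x. poly p x = 0} = UNIV"
      using \<open>\<nexists>a :: 'a. a + a ^ r \<noteq> 0\<close> by (auto simp: p_def poly_monom add.commute)
    ultimately have "r * r \<le> r"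
      using card by simp
    then show False
      using r by simp
  qed
  then obtain a :: 'a where a: "a + a ^ r \<noteq> 0" by blast
  have onto: "\<exists>b. s + (b + b ^ r) = 0" if s: "s ^ r = s" for s :: 'a
  proof -
    define t where "t = a + a ^ r"
    \<comment> \<open>\<open>s\<close> and \<open>t\<close> are fixed by the power map, hence so is
      \<open>c\<close>. The trace is linear over the fixed field, so \<open>c * a\<close> has trace
      \<open>c * t = - s\<close>.\<close>
    define c where "c = (- 1) * s / t"
    have "t ^ r = t"
      unfolding t_def by (simp add: power_add power_power add.commute)
    then have "c ^ r = c"
      unfolding c_def by (simp only: power_divide power_mult_distrib neg_one_power s)
    then have "c * a + (c * a) ^ r = c * t"
      by (simp add: power_mult_distrib t_def algebra_simps)
    also have "\<dots> = - s"
      using a by (simp add: c_def t_def)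
    finally show ?thesis
      by (intro exI[of _ "c * a"]) simp
  qed
  have "polar_space Unitary B Q (\<lambda>v. B v v) (\<lambda>x. x ^ r) 1 (\<lambda>x. x + x ^ r)"
  proof unfold_locales
    show "B (u + v) (u + v) = B u u + B v v + (B u v + B u v ^ r)" for u v
      using swap[of v u] by (simp add: add)
    show "B v u = 1 * B u v ^ r" for u v
      using swap[of v u] by simp
    show "\<exists>a. B v v + (a + a ^ r) = 0" for v
      using onto[of "B v v"] swap[of v v] by simp
    show "v = 0" if "\<And>w. B v w = 0" for v
      using nondeg that by blast
    show "singular Unitary B Q U \<longleftrightarrow>
        vec.subspace U \<and> (\<forall>u\<in>U. B u u = 0) \<and> (\<forall>u\<in>U. \<forall>v\<in>U. B u v = 0)" for U
      unfolding singular_def by auto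
  qed (simp_all add: add scale power_mult_distrib power_power zero_power)
  then show ?thesis by blast
qed

lemma formed_space_polar_space:
  assumes "formed_space K B Q"
  shows "\<exists>q \<sigma> \<epsilon> \<tau>. polar_space K B Q q \<sigma> \<epsilon> \<tau>"
  using assms symplectic_polar_space[of B Q] orthogonal_polar_space[of B Q] unitary_polar_space[of B Q]
  unfolding formed_space_def by (cases K) auto

theorem theorem1p3:
  fixes K :: form_kind
    and B :: "'a::{field,finite} ^ 'n \<Rightarrow> 'a ^ 'n \<Rightarrow> 'a"
    and Q :: "'a ^ 'n \<Rightarrow> 'a"
    and k :: nat
  assumes "formed_space K B Q"
    and "witt_index K B Q \<ge> 2"
    and "1 \<le> k" and "k \<le> witt_index K B Q"
  shows "(geodesic_transitive (pg_vertices K B Q k) (pg_adj K B Q k)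
            \<longleftrightarrow> distance_regular (pg_vertices K B Q k) (pg_adj K B Q k))
       \<and> (distance_regular (pg_vertices K B Q k) (pg_adj K B Q k)
            \<longleftrightarrow> (k = 1 \<or> k = witt_index K B Q))"
proof -
  obtain q \<sigma> \<epsilon> \<tau> where "polar_space K B Q q \<sigma> \<epsilon> \<tau>"
    using formed_space_polar_space[OF assms(1)] by blast
  then interpret polar_space K B Q q \<sigma> \<epsilon> \<tau> .
  show ?thesis
    using assms(2-4) by (rule grassmann_graph_iff)
qed

end
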